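(* Let $\Pi$ be a Poisson process on $\mathbb{L}$ with intensity $\alpha\cdot\mu$, where $\alpha>0$, and let $\mathcal{V}=\mathbb{T}\setminus\bigcup_{\ell\in\Pi}\ell$ be the vacant set. Set $\alpha_0=4\ln 2$. (i) If $\alpha<\alpha_0$, then almost surely $\mathcal{V}$ contains a line. (ii) If $\alpha\geq\alpha_0$, then almost surely $\mathcal{V}$ contains no half-line.
   Context: $\mathbb{T}$ is the $3$-regular tree with graph distance $d$, rooted at a vertex $\varnothing$. A line is the vertex set $\{x_n: n\in\mathbb{Z}\}$ of a bi-infinite geodesic path, i.e. $d(x_m,x_n)=|m-n|$ for all $m,n\in\mathbb{Z}$. $\mathbb{L}$ denotes the set of lines. A half-line is the vertex set $\{x_n:n\ge 0\}$ of an infinite geodesic path $(x_0,x_1,\dots)$ starting at any vertex. A ray is an infinite non-backtracking path $(\varnothing=x_0,x_1,\dots)$, and $\partial\mathbb{T}$ is the set of rays. For distinct rays $\xi,\eta$, $\xi\wedge\eta$ is the vertex farthest from the root common to both, and $\Lambda(\xi,\eta)\in\mathbb{L}$ is the line with ends $\xi$ and $\eta$. $\partial\mathbb{T}$ carries the metric $d(\xi,\eta)=2^{-|\xi\wedge\eta|}$ for $\xi\neq\eta$, where $|x|=d(\varnothing,x)$. $\mathbb{L}$ carries the final topology for the surjection $\Lambda$ from $(\partial\mathbb{T}\times\partial\mathbb{T})\setminus\mathrm{diagonal}$ onto $\mathbb{L}$, and its Borel $\sigma$-algebra. For vertices $x\neq y$, $\langle x,y\rangle$ is the set of lines passing through both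 $x$ and $y$. $\mu$ is the unique Borel measure on $\mathbb{L}$ invariant under all graph automorphisms of $\mathbb{T}$ with $\mu\langle x,y\rangle=2^{-d(x,y)}$ for all $x\neq y$. *)

theory Defs
  imports "HOL-Probability.Probability"
begin

text \<open>Vertices are encoded as lists of naturals: the root is the empty list, the
root has the three children [0],[1],[2], and every other vertex w has the two
children w@[0], w@[1].  Edges join a vertex to its children.\<close>

definition tverts :: "nat list set" where
  "tverts = {w. w = [] \<or> (hd w < 3 \<and> (\<forall>b\<in>set (tl w). b < 2))}"

definition tadj :: "nat list \<Rightarrow> nat list \<Rightarrow> bool" where
  "tadj x y \<longleftrightarrow> x \<in> tverts \<and> y \<in> tverts \<and> ((\<exists>b. y = x @ [b]) \<or> (\<exists>b. x = y @ [b]))"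

text \<open>Graph distance in the tree (the unique path goes through the longest
common prefix).\<close>

fun lcp_len :: "nat list \<Rightarrow> nat list \<Rightarrow> nat" where
  "lcp_len (a # xs) (b # ys) = (if a = b then Suc (lcp_len xs ys) else 0)"
| "lcp_len _ _ = 0"

definition tdist :: "nat list \<Rightarrow> nat list \<Rightarrow> nat" where
  "tdist x y = length x + length y - 2 * lcp_len x y"

definition tree_aut :: "(nat list \<Rightarrow> nat list) \<Rightarrow> bool" where
  "tree_aut g \<longleftrightarrow> bij_betw g tverts tverts \<and>
     (\<forall>x\<in>tverts. \<forall>y\<in>tverts. tadj x y \<longleftrightarrow> tadj (g x) (g y))"

definition tlines :: "nat list set set" where
  "tlines = {L. \<exists>x :: int \<Rightarrow> nat list. (\<forall>n. x n \<in> tverts) \<and>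
                 (\<forall>m n. int (tdist (x m) (x n)) = \<bar>m - n\<bar>) \<and> L = range x}"

definition thalflines :: "nat list set set" where
  "thalflines = {H. \<exists>x :: nat \<Rightarrow> nat list. (\<forall>n. x n \<in> tverts) \<and>
                 (\<forall>m n. int (tdist (x m) (x n)) = \<bar>int m - int n\<bar>) \<and> H = range x}"

definition through2 :: "nat list \<Rightarrow> nat list \<Rightarrow> nat list set set" where
  "through2 x y = {L \<in> tlines. x \<in> L \<and> y \<in> L}"

definition rays :: "(nat \<Rightarrow> nat list) set" where
  "rays = {\<xi>. \<xi> 0 = [] \<and> (\<forall>n. tadj (\<xi> n) (\<xi> (Suc n))) \<and> (\<forall>n. \<xi> (Suc (Suc n)) \<noteq> \<xi> n)}"

text \<open>|xi meet eta| for distinct rays: the last index at which they agree.\<close>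

definition meet_len :: "(nat \<Rightarrow> nat list) \<Rightarrow> (nat \<Rightarrow> nat list) \<Rightarrow> nat" where
  "meet_len \<xi> \<eta> = (LEAST n. \<xi> (Suc n) \<noteq> \<eta> (Suc n))"

definition ray_dist :: "(nat \<Rightarrow> nat list) \<Rightarrow> (nat \<Rightarrow> nat list) \<Rightarrow> real" where
  "ray_dist \<xi> \<eta> = (if \<xi> = \<eta> then 0 else (1/2) ^ meet_len \<xi> \<eta>)"

definition Lam :: "(nat \<Rightarrow> nat list) \<Rightarrow> (nat \<Rightarrow> nat list) \<Rightarrow> nat list set" where
  "Lam \<xi> \<eta> = {\<xi> n | n. n \<ge> meet_len \<xi> \<eta>} \<union> {\<eta> n | n. n \<ge> meet_len \<xi> \<eta>}"

definition ray_top :: "(nat \<Rightarrow> nat list) topology" where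
  "ray_top = Metric_space.mtopology rays ray_dist"

definition offdiag :: "((nat \<Rightarrow> nat list) \<times> (nat \<Rightarrow> nat list)) set" where
  "offdiag = {(\<xi>, \<eta>). \<xi> \<in> rays \<and> \<eta> \<in> rays \<and> \<xi> \<noteq> \<eta>}"

definition line_opens :: "nat list set set set" where
  "line_opens = {U. U \<subseteq> tlines \<and>
     openin (subtopology (prod_topology ray_top ray_top) offdiag)
            {p \<in> offdiag. Lam (fst p) (snd p) \<in> U}}"

definition line_borel :: "nat list set measure" where
  "line_borel = sigma tlines line_opens"

definition is_line_measure :: "nat list set measure \<Rightarrow> bool" where
  "is_line_measure \<mu> \<longleftrightarrow> sets \<mu> = sets line_borel \<and>
     (\<forall>g. tree_aut g \<longrightarrow> (\<forall>A\<in>sets \<mu>. emeasure \<mu> ((\<lambda>L. g ` L) ` A) = emeasure \<mu> A)) \<and>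
     (\<forall>x\<in>tverts. \<forall>y\<in>tverts. x \<noteq> y \<longrightarrow>
        emeasure \<mu> (through2 x y) = ennreal ((1/2) ^ tdist x y))"

definition poisson_process :: "'w measure \<Rightarrow> 'a measure \<Rightarrow> ('w \<Rightarrow> 'a set) \<Rightarrow> bool" where
  "poisson_process M \<nu> PP \<longleftrightarrow> prob_space M \<and>
     (\<forall>\<omega>\<in>space M. PP \<omega> \<subseteq> space \<nu>) \<and>
     (\<forall>A\<in>sets \<nu>. emeasure \<nu> A < \<infinity> \<longrightarrow>
        (AE \<omega> in M. finite (PP \<omega> \<inter> A)) \<and>
        (\<lambda>\<omega>. card (PP \<omega> \<inter> A)) \<in> measurable M (count_space UNIV) \<and>
        (\<forall>k. measure M {\<omega>\<in>space M. card (PP \<omega> \<inter> A) = k} =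
               exp (- enn2real (emeasure \<nu> A)) * enn2real (emeasure \<nu> A) ^ k / fact k)) \<and>
     (\<forall>A\<in>sets \<nu>. emeasure \<nu> A = \<infinity> \<longrightarrow> (AE \<omega> in M. infinite (PP \<omega> \<inter> A))) \<and>
     (\<forall>I (A :: nat \<Rightarrow> 'a set). finite I \<longrightarrow> A ` I \<subseteq> sets \<nu> \<longrightarrow>
        (\<forall>i\<in>I. emeasure \<nu> (A i) < \<infinity>) \<longrightarrow> disjoint_family_on A I \<longrightarrow>
        prob_space.indep_vars M (\<lambda>_. count_space UNIV) (\<lambda>i \<omega>. card (PP \<omega> \<inter> A i)) I)"

definition vacant :: "nat list set set \<Rightarrow> nat list set" where
  "vacant P = tverts - \<Union> P"

end

theory Submission
  imports Defs "HOL-Library.Sublist"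
begin

text \<open>Every line has exactly one vertex closest to the root, its apex.  The lines whose apex is a
  given non-root vertex \<open>v\<close> are those through both children of \<open>v\<close>; they have measure \<open>1/4\<close>, and
  these classes are disjoint for different \<open>v\<close>.  So the sites \<open>v\<close> that are the apex of no line of
  the process form independent site percolation with parameter \<open>p = exp (- \<alpha> / 4)\<close> on binary
  trees, and \<open>p > 1/2\<close> iff \<open>\<alpha> < 4 ln 2\<close>.  A vacant half-line eventually descends through such
  sites.  Conversely, a pair of disjoint infinite descending paths of such sites from a vertex \<open>y\<close>
  can only be hit by a line entering the subtree of \<open>y\<close> from above, and for many far apart subtrees
  the events that no line enters are almost independent.\<close>

section \<open>Lines in the tree\<close>

lemma lcp_len_commute: "lcp_len x y = lcp_len y x"
  by (induction x y rule: lcp_len.induct) auto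

lemma lcp_len_append: "lcp_len (x @ a) (x @ b) = length x + lcp_len a b"
  by (induction x) auto

lemma lcp_len_Nil [simp]: "lcp_len [] x = 0" "lcp_len x [] = 0"
  by (cases x; simp)+

lemma lcp_len_le: "lcp_len x y \<le> length x" "lcp_len x y \<le> length y"
  by (induction x y rule: lcp_len.induct) auto

lemma prefix_if_lcp_len_eq: "lcp_len x y = length x \<Longrightarrow> prefix x y"
  by (induction x y rule: lcp_len.induct) (auto split: if_splits)

text \<open>The two words part before \<open>v\<close> ends, so letters appended to \<open>v\<close>
  are never compared. Hence \<open>u\<close> is equally far from all words
  \<open>v @ [b]\<close>.\<close>

lemma lcp_len_append_not_prefix:
  "\<not> prefix v u \<Longrightarrow> lcp_len u (v @ s) = lcp_len u v \<and> lcp_len u v < length v"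
  by (induction u v rule: lcp_len.induct) auto

lemma tdist_commute: "tdist x y = tdist y x"
  by (simp add: tdist_def lcp_len_commute[of x y])

lemma tdist_append [simp]: "tdist (x @ a) (x @ b) = tdist a b"
  by (simp add: tdist_def lcp_len_append)

lemma tdist_Nil [simp]: "tdist [] x = length x" "tdist x [] = length x"
  by (simp_all add: tdist_def)

lemma tdist_self [simp]: "tdist x x = 0"
  using tdist_append[of x "[]" "[]"] by simp

lemma tdist_siblings: "a \<noteq> b \<Longrightarrow> tdist (v @ [a]) (v @ [b]) = 2"
  by (subst tdist_append) (simp add: tdist_def)

lemma tdist_prefix: "prefix x y \<Longrightarrow> tdist x y = length y - length x"
  using tdist_append[of x "[]"] by (auto simp: prefix_def)

lemma tdist_eq_1D:
  assumes "tdist x y = 1"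
  shows "(\<exists>b. y = x @ [b]) \<or> (\<exists>b. x = y @ [b])"
proof -
  \<comment> \<open>The distance is the sum of the excesses of both lengths over the common prefix,
    so one excess is 0 and the other 1.\<close>
  have "lcp_len x y = length x \<and> length y = Suc (length x) \<or>
        lcp_len y x = length y \<and> length x = Suc (length y)"
    using assms le_Suc_ex[OF lcp_len_le(1)[of x y]] le_Suc_ex[OF lcp_len_le(2)[of x y]]
    unfolding tdist_def lcp_len_commute[of y x] by (auto simp: add_is_1)
  moreover have "\<exists>b. w = v @ [b]" if "lcp_len v w = length v" "length w = Suc (length v)" for v w
  proof -
    have "prefix v w" using that(1) by (rule prefix_if_lcp_len_eq)
    then obtain zs where "w = v @ zs" by (auto simp: prefix_def)
    with that(2) show ?thesis by (auto simp: length_Suc_conv)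
  qed
  ultimately show ?thesis by blast
qed

lemma tverts_snoc: "v \<in> tverts \<Longrightarrow> v \<noteq> [] \<Longrightarrow> v @ [b] \<in> tverts \<longleftrightarrow> b < 2"
  by (cases v) (auto simp: tverts_def)

lemma tverts_child: "v \<in> tverts \<Longrightarrow> b < 2 \<Longrightarrow> v @ [b] \<in> tverts"
  by (cases v) (auto simp: tverts_def)

lemma tverts_snocD: "v @ [b] \<in> tverts \<Longrightarrow> v \<in> tverts"
  by (cases v) (auto simp: tverts_def)

section \<open>The apex of a line\<close>

definition descendants :: "nat list \<Rightarrow> nat list set" where
  "descendants v = {w \<in> tverts. prefix v w}"

text \<open>Written as a set \<open>through2\<close>, so that its measure is the prescribed one. At
  the root this misses the lines through the third child \<open>[2]\<close>, hence the restriction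
  to non-root vertices later.\<close>

definition apex_lines :: "nat list \<Rightarrow> nat list set set" where
  "apex_lines v = through2 (v @ [0]) (v @ [1])"

lemma tlinesE:
  assumes "L \<in> tlines"
  obtains x :: "int \<Rightarrow> nat list" where "L = range x" "\<And>n. x n \<in> tverts"
    "\<And>m n. int (tdist (x m) (x n)) = \<bar>m - n\<bar>"
  using assms by (auto simp: tlines_def)

text \<open>A line is an isometric copy of the integers, where two points equally far from a third
  coincide or lie symmetrically about it.\<close>

lemma tlines_isosceles:
  assumes "L \<in> tlines" "a \<in> L" "b \<in> L" "c \<in> L" "tdist a b = tdist a c"
  shows "tdist b c = 0 \<or> tdist b c = 2 * tdist a b"
proof -
  from assms(1) obtain x where x: "L = range x" "\<And>m n. int (tdist (x m) (x n)) = \<bar>m - n\<bar>"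
    by (metis tlinesE)
  obtain i j k where "a = x i" "b = x j" "c = x k" using assms x(1) by auto
  then have "int (tdist a b) = \<bar>i - j\<bar>" "int (tdist a c) = \<bar>i - k\<bar>" "int (tdist b c) = \<bar>j - k\<bar>"
    using x(2) by auto
  with assms(5) show ?thesis by linarith
qed

text \<open>A vertex of the line outside the subtree of \<open>v\<close> would be equally far from
  both children of \<open>v\<close>, at distance at least 2. On a line the children would then be 0
  or at least 4 apart, but their distance is 2.\<close>

lemma apex_lines_prefix:
  assumes "L \<in> apex_lines v" "u \<in> L"
  shows "prefix v u"
proof (rule ccontr)
  assume "\<not> prefix v u"
  note * = lcp_len_append_not_prefix[OF this]
  have L: "L \<in> tlines" "v @ [0] \<in> L" "v @ [1] \<in> L"
    using assms(1) by (auto simp: apex_lines_def through2_def)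
  have 2: "tdist (v @ [0]) (v @ [1]) = 2" by (rule tdist_siblings) simp
  have eq: "tdist u (v @ [b]) = length u + length v + 1 - 2 * lcp_len u v" for b
    using * by (simp add: tdist_def)
  have "tdist (v @ [0]) (v @ [1]) = 0 \<or> tdist (v @ [0]) (v @ [1]) = 2 * tdist u (v @ [0])"
    by (rule tlines_isosceles[OF L(1) assms(2) L(2,3)]) (simp add: eq)
  moreover have "tdist u (v @ [0]) \<ge> 2"
    using *[of "[]"] lcp_len_le(1)[of u v] unfolding eq by linarith
  ultimately show False using 2 by simp
qed

text \<open>\<open>v\<close> is a prefix of both \<open>w @ [0]\<close> and \<open>w @ [1]\<close>,
  hence of \<open>w\<close>, and the situation is symmetric. This disjointness makes the sites
  independent.\<close>

lemma apex_lines_disjoint: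
  assumes "L \<in> apex_lines v" "L \<in> apex_lines w"
  shows "v = w"
proof -
  have "prefix v w" if "L \<in> apex_lines v" "L \<in> apex_lines w" for v w
  proof -
    have "w @ [0] \<in> L" "w @ [1] \<in> L"
      using that(2) by (auto simp: apex_lines_def through2_def)
    then have "prefix v (w @ [0])" "prefix v (w @ [1])"
      using apex_lines_prefix[OF that(1)] by blast+
    then show ?thesis by auto
  qed
  with assms show ?thesis by (meson prefix_order.antisym)
qed

lemma apex_in_line:
  assumes "L \<in> apex_lines v"
  shows "v \<in> L"
proof -
  have L: "L \<in> tlines" "v @ [0] \<in> L" "v @ [1] \<in> L"
    using assms by (auto simp: apex_lines_def through2_def)
  from L(1) obtain x where x: "L = range x" "\<And>m n. int (tdist (x m) (x n)) = \<bar>m - n\<bar>"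
    by (metis tlinesE)
  obtain i j where ij: "v @ [0] = x i" "v @ [1] = x j" using L x(1) by auto
  have "tdist (v @ [0]) (v @ [1]) = 2" by (rule tdist_siblings) simp
  with x(2)[of i j] ij have ij2: "\<bar>i - j\<bar> = 2" by simp
  \<comment> \<open>The indices of the two children differ by 2. The vertex halfway is adjacent to
    both, which only \<open>v\<close> is.\<close>
  define k where "k = (i + j) div 2"
  have "\<bar>k - i\<bar> = 1" "\<bar>k - j\<bar> = 1" using ij2 unfolding k_def by presburger+
  then have "tdist (x k) (v @ [0]) = 1" "tdist (x k) (v @ [1]) = 1"
    using x(2)[of k i] x(2)[of k j] ij by auto
  from this[THEN tdist_eq_1D] have "x k = v" by auto
  then show ?thesis using x(1) by auto
qed

text \<open>If neither of the two neighbours of \<open>u\<close> on the line is its parent, they are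
  its children, and a non-root vertex has only two.\<close>

lemma parent_or_apex:
  assumes "L \<in> tlines" "u \<in> L" "u \<noteq> []"
  shows "butlast u \<in> L \<or> L \<in> apex_lines u"
proof (rule disjCI)
  assume "L \<notin> apex_lines u"
  show "butlast u \<in> L"
  proof (rule ccontr)
    assume nb: "butlast u \<notin> L"
    from assms(1) obtain x where x: "L = range x" "\<And>n. x n \<in> tverts"
      "\<And>m n. int (tdist (x m) (x n)) = \<bar>m - n\<bar>"
      by (metis tlinesE)
    obtain n where n: "u = x n" using assms(2) x(1) by auto
    have child: "\<exists>b<2. x k = u @ [b]" if "\<bar>k - n\<bar> = 1" for k
    proof -
      have "tdist u (x k) = 1" using x(3)[of n k] that n by simp
      moreover have "x k \<noteq> butlast u" using nb x(1) by (metis rangeI)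
      ultimately obtain b where "x k = u @ [b]" using tdist_eq_1D[of u "x k"] by auto
      with x(2)[of k] x(2)[of n] n assms(3) tverts_snoc show ?thesis by auto
    qed
    obtain b c where bc: "b < 2" "c < 2" "x (n + 1) = u @ [b]" "x (n - 1) = u @ [c]"
      using child[of "n + 1"] child[of "n - 1"] by auto
    have "x (n + 1) \<noteq> x (n - 1)" using x(3)[of "n + 1" "n - 1"] by auto
    with bc have "{b, c} = {0, 1}" by auto
    with bc have "{u @ [0], u @ [1]} \<subseteq> {x (n + 1), x (n - 1)}" by (auto simp: doubleton_eq_iff)
    then have "u @ [0] \<in> L" "u @ [1] \<in> L" using x(1) by auto
    then show False
      using assms(1) \<open>L \<notin> apex_lines u\<close> by (auto simp: apex_lines_def through2_def)
  qed
qed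

text \<open>Climb from \<open>y @ s\<close> towards the root with \<open>parent_or_apex\<close>:
  either the climb stops at the apex of \<open>L\<close> in the subtree of \<open>y\<close>, or it
  passes \<open>y\<close> and \<open>L\<close> uses the edge above \<open>y\<close>.\<close>

lemma line_exits_or_apex:
  assumes L: "L \<in> tlines" and y: "y \<noteq> []"
  shows "y @ s \<in> L \<Longrightarrow> butlast y \<in> L \<and> y \<in> L \<or>
    (\<exists>v. prefix y v \<and> prefix v (y @ s) \<and> L \<in> apex_lines v)"
proof (induction s rule: rev_induct)
  case Nil
  then show ?case using parent_or_apex[OF L _ y] by auto
next
  case (snoc b s)
  from parent_or_apex[OF L snoc.prems] y consider "y @ s \<in> L" | "L \<in> apex_lines (y @ s @ [b])"
    by (auto simp: butlast_append)
  then show ?case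
  proof cases
    case 1
    with snoc.IH have "butlast y \<in> L \<and> y \<in> L \<or>
      (\<exists>v. prefix y v \<and> prefix v (y @ s) \<and> L \<in> apex_lines v)" by blast
    then show ?thesis by (metis append_assoc prefix_prefix)
  qed (metis prefixI prefix_order.order_refl)
qed

text \<open>Word length cannot fall forever, so some step leads to a child. From then on a step to
  the parent would backtrack.\<close>

lemma halfline_descends:
  assumes "H \<in> thalflines"
  obtains z :: "nat \<Rightarrow> nat list" where "\<And>k. z k \<in> H" "\<And>k. z k \<in> tverts" "z 0 \<noteq> []"
    "\<And>k. \<exists>b<2. z (Suc k) = z k @ [b]"
proof -
  from assms obtain x where x: "H = range x" "\<And>n. x n \<in> tverts"
    "\<And>m n. int (tdist (x m) (x n)) = \<bar>int m - int n\<bar>"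
    by (auto simp: thalflines_def)
  have step: "(\<exists>b. x (Suc n) = x n @ [b]) \<or> (\<exists>b. x n = x (Suc n) @ [b])" for n
  proof -
    have "tdist (x n) (x (Suc n)) = 1" using x(3)[of n "Suc n"] by simp
    then show ?thesis by (rule tdist_eq_1D)
  qed
  have nb: "x (Suc (Suc n)) \<noteq> x n" for n using x(3)[of "Suc (Suc n)" n] by auto
  have "\<exists>n b. x (Suc n) = x n @ [b]"
  proof (rule ccontr)
    assume *: "\<nexists>n b. x (Suc n) = x n @ [b]"
    have "length (x n) + n = length (x 0)" for n
    proof (induction n)
      case (Suc n)
      from step[of n] * obtain b where "x n = x (Suc n) @ [b]" by auto
      with Suc show ?case by simp
    qed simp
    from this[of "Suc (length (x 0))"] show False by simp
  qed
  then obtain N b where N: "x (Suc N) = x N @ [b]" by auto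
  have down: "\<exists>b. x (Suc (N + k)) = x (N + k) @ [b]" for k
  proof (induction k)
    case (Suc k)
    with step[of "N + Suc k"] nb[of "N + k"] show ?case by auto
  qed (use N in auto)
  \<comment> \<open>Starting after the first step down ensures that \<open>z 0\<close> is not the
    root.\<close>
  define z where "z k = x (Suc (N + k))" for k
  have nonempty: "z k \<noteq> []" for k using down[of k] by (auto simp: z_def)
  show thesis
  proof (rule that[of z])
    fix k
    obtain b where b: "z (Suc k) = z k @ [b]" using down[of "Suc k"] by (auto simp: z_def)
    have "b < 2" using x(2) tverts_snoc[of "z k" b] nonempty[of k] b unfolding z_def by metis
    with b show "\<exists>b<2. z (Suc k) = z k @ [b]" by auto
  next
    show "z k \<in> H" "z k \<in> tverts" for k using x by (auto simp: z_def)
  qed (rule nonempty)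
qed

text \<open>The line is parametrised with \<open>y\<close> at 0, \<open>f\<close> on the positive
  and \<open>g\<close> on the negative integers.\<close>

lemma two_rays_line:
  assumes f: "f 0 = y @ [0]" "\<And>k. \<exists>b. f (Suc k) = f k @ [b]" "\<And>k. f k \<in> tverts"
    and g: "g 0 = y @ [1]" "\<And>k. \<exists>b. g (Suc k) = g k @ [b]" "\<And>k. g k \<in> tverts"
  shows "insert y (range f \<union> range g) \<in> tlines"
proof -
  \<comment> \<open>\<open>s h k\<close> is the word leading from \<open>y\<close> to the vertex at
    distance \<open>k\<close> along \<open>h\<close>. As \<open>h 0\<close> is already a child of
    \<open>y\<close>, \<open>h j\<close> belongs to \<open>Suc j\<close>, and 0 stands for
    \<open>y\<close> itself.\<close>
  define s :: "(nat \<Rightarrow> nat list) \<Rightarrow> nat \<Rightarrow> nat list"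
    where "s h k = (case k of 0 \<Rightarrow> [] | Suc j \<Rightarrow> drop (length y) (h j))" for h k
  have ex: "\<exists>t. h j = y @ a # t \<and> length t = j"
    if "h 0 = y @ [a]" "\<And>k. \<exists>b. h (Suc k) = h k @ [b]" for h :: "nat \<Rightarrow> nat list" and a j
  proof (induction j)
    case (Suc j)
    then show ?case using that(2)[of j] by auto
  qed (use that in auto)
  have fs: "f j = y @ s f (Suc j)" "\<exists>t. s f (Suc j) = 0 # t" "length (s f (Suc j)) = Suc j" for j
    using ex[OF f(1,2), of j] by (auto simp: s_def)
  have gs: "g j = y @ s g (Suc j)" "\<exists>t. s g (Suc j) = 1 # t" "length (s g (Suc j)) = Suc j" for j
    using ex[OF g(1,2), of j] by (auto simp: s_def)
  have len: "length (s f k) = k" "length (s g k) = k" for k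
    using fs(3) gs(3) by (cases k; simp add: s_def)+
  have step: "\<exists>b. s h (Suc k) = s h k @ [b]"
    if "h 0 = y @ [a]" "\<And>k. \<exists>b. h (Suc k) = h k @ [b]" for h :: "nat \<Rightarrow> nat list" and a k
  proof (cases k)
    case (Suc j)
    with ex[OF that, of j] that(2)[of j] show ?thesis by (auto simp: s_def)
  qed (use that in \<open>auto simp: s_def\<close>)
  have "prefix (s f i) (s f (i + d))" "prefix (s g i) (s g (i + d))" for i d
  proof (induction d)
    case (Suc d)
    { case 1 show ?case using Suc step[OF f(1,2), of "i + d"] by (auto intro: prefix_order.trans) }
    { case 2 show ?case using Suc step[OF g(1,2), of "i + d"] by (auto intro: prefix_order.trans) }
  qed auto
  then have pre: "i \<le> j \<Longrightarrow> prefix (s f i) (s f j)" "i \<le> j \<Longrightarrow> prefix (s g i) (s g j)" for i j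
    by (metis le_add_diff_inverse)+
  have same: "int (tdist (s f i) (s f j)) = \<bar>int i - int j\<bar>"
      "int (tdist (s g i) (s g j)) = \<bar>int i - int j\<bar>" for i j
  proof -
    have *: "int (tdist u w) = \<bar>int (length u) - int (length w)\<bar>"
      if "prefix u w \<or> prefix w u" for u w
      using that tdist_prefix[of u w] tdist_prefix[of w u] tdist_commute[of u w]
        prefix_length_le[of u w] prefix_length_le[of w u]
      by (elim disjE) simp_all
    show "int (tdist (s f i) (s f j)) = \<bar>int i - int j\<bar>"
      using *[of "s f i" "s f j"] pre(1) nat_le_linear[of i j] len by metis
    show "int (tdist (s g i) (s g j)) = \<bar>int i - int j\<bar>"
      using *[of "s g i" "s g j"] pre(2) nat_le_linear[of i j] len by metis
  qed
  have cross: "tdist (s f i) (s g j) = i + j" for i j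
  proof -
    \<comment> \<open>Nonempty words on the two branches begin with 0 and 1 respectively, so the
      lengths add up.\<close>
    have "lcp_len (s f i) (s g j) = 0"
    proof (cases i)
      case (Suc i')
      show ?thesis
      proof (cases j)
        case (Suc j')
        with \<open>i = Suc i'\<close> fs(2)[of i'] gs(2)[of j'] show ?thesis by auto
      qed (simp add: s_def)
    qed (simp add: s_def)
    then show ?thesis by (simp add: tdist_def len)
  qed
  define x :: "int \<Rightarrow> nat list"
    where "x n = y @ (if n \<ge> 0 then s f (nat n) else s g (nat (- n)))" for n
  have dist: "int (tdist (x m) (x n)) = \<bar>m - n\<bar>" for m n
    using same[of "nat m" "nat n"] same[of "nat (- m)" "nat (- n)"]
      cross[of "nat m" "nat (- n)"] cross[of "nat n" "nat (- m)"]
      tdist_commute[of "s f (nat n)" "s g (nat (- m))"]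
    by (simp add: x_def abs_minus_commute)
  have xf: "x (int (Suc j)) = f j" and xg: "x (- int (Suc j)) = g j" for j
    using fs(1)[of j] gs(1)[of j] by (simp_all add: x_def nat_add_distrib del: of_nat_Suc)
  have x0: "x 0 = y" by (simp add: x_def s_def)
  have cases_int: "x n = y \<or> (\<exists>j. x n = f j) \<or> (\<exists>j. x n = g j)" for n
  proof (cases n rule: int_cases3)
    case (pos k)
    then obtain j where "n = int (Suc j)" using gr0_implies_Suc by blast
    then show ?thesis using xf by metis
  next
    case (neg k)
    then obtain j where "n = - int (Suc j)" using gr0_implies_Suc by blast
    then show ?thesis using xg by metis
  qed (simp add: x0)
  have y: "y \<in> tverts" using f(3)[of 0] f(1) tverts_snocD by auto
  have rng: "range x = insert y (range f \<union> range g)"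
  proof
    show "range x \<subseteq> insert y (range f \<union> range g)" using cases_int by blast
    have "y \<in> range x" using x0 by (metis rangeI)
    moreover have "f j \<in> range x" "g j \<in> range x" for j using xf xg by (metis rangeI)+
    ultimately show "insert y (range f \<union> range g) \<subseteq> range x" by blast
  qed
  have "x n \<in> tverts" for n
    using cases_int[of n] f(3) g(3) y by (elim disjE exE) simp_all
  with dist rng show ?thesis unfolding tlines_def by blast
qed

section \<open>Site percolation on the descendants of a vertex\<close>

text \<open>The singletons \<open>{Z i}\<close> are stable under intersection, so independence
  passes to the sigma-algebras generated by disjoint blocks of indices; a boolean labels the two
  blocks.\<close>

lemma (in prob_space) indep_events_prob_Int:
  assumes "indep_events Z I" "J \<subseteq> I" "K \<subseteq> I" "J \<inter> K = {}"
    and "A \<in> sigma_sets (space M) (Z ` J)" "B \<in> sigma_sets (space M) (Z ` K)"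
  shows "prob (A \<inter> B) = prob A * prob B"
proof -
  have "indep_sets (\<lambda>i. {Z i}) (\<Union>b\<in>UNIV. case_bool J K b)"
    using assms(1,2,3) unfolding indep_events_def_alt
    by (rule_tac indep_sets_mono_index[of _ I]) (auto split: bool.splits)
  then have "indep_sets (\<lambda>b. sigma_sets (space M) (\<Union>i\<in>case_bool J K b. {Z i})) UNIV"
    by (rule indep_sets_collect_sigma)
      (use assms(4) in \<open>auto simp: disjoint_family_on_def Int_stable_def split: bool.splits\<close>)
  also have "(\<lambda>b. sigma_sets (space M) (\<Union>i\<in>case_bool J K b. {Z i})) =
      case_bool (sigma_sets (space M) (Z ` J)) (sigma_sets (space M) (Z ` K))"
    by (rule ext) (simp add: UNION_singleton_eq_range split: bool.split)
  finally have "indep_set (sigma_sets (space M) (Z ` J)) (sigma_sets (space M) (Z ` K))"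
    by (simp add: indep_set_def)
  from indep_setD[OF this assms(5,6)] show ?thesis .
qed

text \<open>Below, \<open>Z u\<close> is the event that the site \<open>u\<close> is open.\<close>

fun surv :: "(nat list \<Rightarrow> 'w set) \<Rightarrow> nat \<Rightarrow> nat list \<Rightarrow> 'w set" where
  "surv Z 0 v = Z v"
| "surv Z (Suc n) v = Z v \<inter> (surv Z n (v @ [0]) \<union> surv Z n (v @ [1]))"

definition perc :: "(nat list \<Rightarrow> 'w set) \<Rightarrow> nat list \<Rightarrow> 'w set" where
  "perc Z v = (\<Inter>n. surv Z n v)"

lemma surv_Suc_subset: "surv Z (Suc n) v \<subseteq> surv Z n v"
proof (induction n arbitrary: v)
  case (Suc n)
  then show ?case by (subst surv.simps(2), subst (2) surv.simps(2)) blast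
qed simp

lemma decseq_surv: "decseq (\<lambda>n. surv Z n v)"
  by (rule decseq_SucI) (rule surv_Suc_subset)

lemma surv_if_path:
  assumes "\<And>k. \<omega> \<in> Z (z k)" "\<And>k. \<exists>b<2. z (Suc k) = z k @ [b]"
  shows "\<omega> \<in> surv Z n (z k)"
proof (induction n arbitrary: k)
  case (Suc n)
  obtain b where "b < 2" "z (Suc k) = z k @ [b]" using assms(2) by blast
  with Suc[of "Suc k"] assms(1)[of k] show ?case by (auto simp: less_2_cases_iff)
qed (use assms in simp)

text \<open>Compactness: if the children die out at depths \<open>m\<close> and \<open>n\<close>,
  both are dead at depth \<open>max m n\<close>, because survival decreases with depth, and
  \<open>v\<close> is dead one level later.\<close>

lemma perc_child:
  assumes "\<omega> \<in> perc Z v"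
  shows "\<exists>b<2. \<omega> \<in> perc Z (v @ [b])"
proof (rule ccontr)
  assume "\<not> ?thesis"
  then have "\<omega> \<notin> perc Z (v @ [0])" "\<omega> \<notin> perc Z (v @ [1])" by auto
  then obtain m n where mn: "\<omega> \<notin> surv Z m (v @ [0])" "\<omega> \<notin> surv Z n (v @ [1])"
    by (auto simp: perc_def)
  have "\<omega> \<in> surv Z (Suc (max m n)) v" using assms unfolding perc_def by blast
  then have "\<omega> \<in> surv Z (max m n) (v @ [0]) \<or> \<omega> \<in> surv Z (max m n) (v @ [1])" by simp
  then show False
    using mn decseqD[OF decseq_surv, of m "max m n" Z] decseqD[OF decseq_surv, of n "max m n" Z]
    by (meson max.cobounded1 max.cobounded2 subsetD)
qed

lemma perc_path:
  assumes "\<omega> \<in> perc Z v" "v \<in> tverts"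
  obtains f where "f 0 = v" "\<And>k. \<omega> \<in> Z (f k)" "\<And>k. f k \<in> descendants v"
    "\<And>k. \<exists>b. f (Suc k) = f k @ [b]"
proof -
  \<comment> \<open>The clause for \<open>n = 0\<close> pins the start of the chosen path to
    \<open>v\<close>.\<close>
  define P where "P n u \<longleftrightarrow> u \<in> descendants v \<and> \<omega> \<in> perc Z u \<and> (n = 0 \<longrightarrow> u = v)"
    for n :: nat and u
  define Q :: "nat \<Rightarrow> nat list \<Rightarrow> nat list \<Rightarrow> bool" where "Q n u w \<longleftrightarrow> (\<exists>b. w = u @ [b])" for n u w
  have "\<exists>f. \<forall>n. P n (f n) \<and> Q n (f n) (f (Suc n))"
  proof (rule dependent_nat_choice)
    show "\<exists>u. P 0 u" using assms by (auto simp: P_def descendants_def)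
  next
    fix u and n :: nat
    assume u: "P n u"
    then obtain b where b: "b < 2" "\<omega> \<in> perc Z (u @ [b])" 
      using perc_child[of \<omega> Z u] by (auto simp: P_def)
    have "P (Suc n) (u @ [b])" using u b by (auto simp: P_def descendants_def tverts_child)
    then show "\<exists>w. P (Suc n) w \<and> Q n u w" by (auto simp: Q_def)
  qed
  then obtain f where "\<And>n. P n (f n)" "\<And>n. Q n (f n) (f (Suc n))" by blast
  then have f: "\<And>n. f n \<in> descendants v" "\<And>n. \<omega> \<in> perc Z (f n)" "f 0 = v"
    "\<And>n. \<exists>b. f (Suc n) = f n @ [b]" by (auto simp: P_def Q_def)
  have "perc Z u \<subseteq> Z u" for u unfolding perc_def by (rule INF_lower2[of 0]) auto
  then have "\<omega> \<in> Z (f k)" for k using f(2)[of k] by blast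
  with f show thesis by (intro that[of f]) auto
qed

text \<open>A site survives one more level if it is open and not both children fail; the two
  failures are independent, whence the square.\<close>

fun surv_prob :: "real \<Rightarrow> nat \<Rightarrow> real" where
  "surv_prob p 0 = p"
| "surv_prob p (Suc n) = p * (1 - (1 - surv_prob p n)\<^sup>2)"

lemma surv_prob_bounds:
  assumes "0 \<le> p" "p \<le> 1"
  shows "0 \<le> surv_prob p n \<and> surv_prob p n \<le> 1"
proof (induction n)
  case (Suc n)
  then have "(1 - surv_prob p n)\<^sup>2 \<le> 1" "(1 - surv_prob p n)\<^sup>2 \<ge> 0"
    by (auto intro: power_le_one)
  with assms show ?case by (auto intro!: mult_nonneg_nonneg mult_le_one)
qed (use assms in auto)

text \<open>As \<open>2 * p \<le> 1\<close>, the sequence decreases, and its limit \<open>l\<close>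
  is a fixed point: \<open>l * ((1 - 2 * p) + p * l) = 0\<close>. The second factor is positive for
  \<open>l > 0\<close>, at \<open>p = 1 / 2\<close> thanks to the term \<open>p * l\<close>.\<close>

lemma surv_prob_subcritical:
  assumes p: "0 < p" "p \<le> 1 / 2"
  shows "surv_prob p \<longlonglongrightarrow> 0"
proof -
  have b: "0 \<le> surv_prob p n \<and> surv_prob p n \<le> 1" for n
    using p by (intro surv_prob_bounds) auto
  have "surv_prob p (Suc n) \<le> surv_prob p n" for n
  proof -
    let ?t = "surv_prob p n"
    have "surv_prob p (Suc n) = (2 * p) * ?t - p * ?t\<^sup>2" by (simp add: power2_eq_square algebra_simps)
    also have "\<dots> \<le> 1 * ?t - 0" using p b[of n] by (intro diff_mono mult_right_mono) auto
    finally show ?thesis by simp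
  qed
  then have "decseq (surv_prob p)" by (rule decseq_SucI)
  then obtain l where l: "surv_prob p \<longlonglongrightarrow> l" "\<forall>n. l \<le> surv_prob p n"
    using decseq_convergent[of "surv_prob p" 0] b by blast
  have "l \<ge> 0" using l(1) b by (intro LIMSEQ_le_const[of "surv_prob p"]) auto
  have "(\<lambda>n. surv_prob p (Suc n)) \<longlonglongrightarrow> p * (1 - (1 - l)\<^sup>2)"
    unfolding surv_prob.simps by (intro tendsto_intros l)
  with LIMSEQ_Suc[OF l(1)] have "l = p * (1 - (1 - l)\<^sup>2)" by (rule LIMSEQ_unique)
  then have "l * ((1 - 2 * p) + p * l) = 0" by (simp add: power2_eq_square algebra_simps)
  moreover have "(1 - 2 * p) + p * l > 0" if "l > 0" using that p by (simp add: add_nonneg_pos)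
  ultimately have "l = 0" using \<open>l \<ge> 0\<close> by (cases "l = 0") auto
  with l show ?thesis by simp
qed

text \<open>\<open>2 - 1 / p\<close> is the nonzero fixed point of the recursion.\<close>

lemma surv_prob_supercritical:
  assumes p: "1 / 2 < p" "p \<le> 1"
  shows "2 - 1 / p \<le> surv_prob p n"
proof (induction n)
  case 0
  have "2 * p - 1 \<le> p * p" using zero_le_square[of "p - 1"] by (simp add: algebra_simps)
  with p show ?case by (simp add: field_simps)
next
  case (Suc n)
  define t where "t = 2 - 1 / p"
  have "surv_prob p n \<le> 1" using surv_prob_bounds[of p n] p by auto
  with Suc have "(1 - surv_prob p n)\<^sup>2 \<le> (1 - t)\<^sup>2" by (intro power_mono) (auto simp: t_def)
  then have "p * (1 - (1 - t)\<^sup>2) \<le> surv_prob p (Suc n)" using p by (simp add: mult_left_mono)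
  moreover have "p * (1 - (1 - t)\<^sup>2) = t"
    using p by (simp add: t_def power2_eq_square field_simps)
  ultimately show ?case by (simp add: t_def)
qed

text \<open>The root is left out because it has three children; below any other vertex the tree is
  binary.\<close>

locale site_percolation = prob_space M for M :: "'w measure" +
  fixes Z :: "nat list \<Rightarrow> 'w set" and p :: real
  assumes indep: "indep_events Z (tverts - {[]})"
    and prob_open: "v \<in> tverts \<Longrightarrow> v \<noteq> [] \<Longrightarrow> prob (Z v) = p"
begin

section \<open>Survival, percolation and fork events in a subtree\<close>

abbreviation below :: "nat list \<Rightarrow> 'w set set" where
  "below v \<equiv> sigma_sets (space M) (Z ` descendants v)"

lemma Z_events: "v \<in> tverts \<Longrightarrow> v \<noteq> [] \<Longrightarrow> Z v \<in> events"
  using indep unfolding indep_events_def by auto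

lemma descendants_subset: "v \<noteq> [] \<Longrightarrow> descendants v \<subseteq> tverts - {[]}"
  by (auto simp: descendants_def)

lemma below_Pow: "v \<noteq> [] \<Longrightarrow> Z ` descendants v \<subseteq> Pow (space M)"
  using sets.sets_into_space[OF Z_events] descendants_subset[of v] by fast

lemma below_events: "v \<noteq> [] \<Longrightarrow> A \<in> below v \<Longrightarrow> A \<in> events"
proof -
  assume v: "v \<noteq> []" and A: "A \<in> below v"
  have "Z ` descendants v \<subseteq> events" using Z_events descendants_subset[OF v] by fast
  then show "A \<in> events" using A sets.sigma_sets_subset by blast
qed

lemma descendants_child:
  "descendants (v @ [b]) \<subseteq> descendants v - {v}" "a \<noteq> b \<Longrightarrow> descendants (v @ [a]) \<inter> descendants (v @ [b]) = {}"
  by (auto simp: descendants_def prefix_def)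

lemma below_child: "below (v @ [b]) \<subseteq> sigma_sets (space M) (Z ` (descendants v - {v}))"
  by (intro sigma_sets_mono' image_mono descendants_child)

lemma below_child': "below (v @ [b]) \<subseteq> below v"
  using descendants_child(1) by (intro sigma_sets_mono' image_mono) blast

lemma surv_below:
  assumes "v \<in> tverts" "v \<noteq> []"
  shows "surv Z n v \<in> below v"
  using assms
proof (induction n arbitrary: v)
  case 0
  then show ?case by (auto simp: descendants_def)
next
  case (Suc n)
  interpret A: sigma_algebra "space M" "below v"
    using below_Pow[OF Suc.prems(2)] by (rule sigma_algebra_sigma_sets)
  have "surv Z n (v @ [b]) \<in> below v" if "b < 2" for b
    using Suc.IH[of "v @ [b]"] tverts_child[OF Suc.prems(1) that] below_child' by blast
  from this[of 0] this[of 1] have "surv Z n (v @ [0]) \<union> surv Z n (v @ [1]) \<in> below v"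
    using A.Un by auto
  moreover have "Z v \<in> below v" using Suc.prems by (auto simp: descendants_def)
  ultimately show ?case unfolding surv.simps by blast
qed

lemma perc_below:
  assumes "v \<in> tverts" "v \<noteq> []"
  shows "perc Z v \<in> below v"
proof -
  interpret A: sigma_algebra "space M" "below v"
    using below_Pow[OF assms(2)] by (rule sigma_algebra_sigma_sets)
  show ?thesis unfolding perc_def by (rule A.countable_INT) (use surv_below[OF assms] in auto)
qed

lemma prob_children:
  assumes v: "v \<in> tverts" "v \<noteq> []" and AB: "A \<in> below (v @ [0])" "B \<in> below (v @ [1])"
  shows "prob (A \<inter> B) = prob A * prob B"
proof (rule indep_events_prob_Int[OF indep _ _ _ AB])
  show "descendants (v @ [0]) \<inter> descendants (v @ [1]) = {}"
    by (rule descendants_child(2)) simp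
qed (rule descendants_subset, simp)+

lemma prob_root:
  assumes v: "v \<in> tverts" "v \<noteq> []" and A: "A \<in> sigma_sets (space M) (Z ` (descendants v - {v}))"
  shows "prob (Z v \<inter> A) = p * prob A"
proof -
  have "prob (Z v \<inter> A) = prob (Z v) * prob A"
  proof (rule indep_events_prob_Int[OF indep _ _ _ _ A])
    show "Z v \<in> sigma_sets (space M) (Z ` {v})" by simp
    show "{v} \<subseteq> tverts - {[]}" using v by simp
    show "descendants v - {v} \<subseteq> tverts - {[]}" using descendants_subset[OF v(2)] by blast
  qed simp
  then show ?thesis using prob_open[OF v] by simp
qed

lemma strict_below_algebra:
  "v \<noteq> [] \<Longrightarrow> sigma_algebra (space M) (sigma_sets (space M) (Z ` (descendants v - {v})))"
  using below_Pow[of v] by (intro sigma_algebra_sigma_sets) blast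

lemma prob_surv:
  assumes "v \<in> tverts" "v \<noteq> []"
  shows "prob (surv Z n v) = surv_prob p n"
  using assms
proof (induction n arbitrary: v)
  case 0
  then show ?case by (simp add: prob_open)
next
  case (Suc n)
  interpret A: sigma_algebra "space M" "sigma_sets (space M) (Z ` (descendants v - {v}))"
    using strict_below_algebra[OF Suc.prems(2)] .
  let ?A = "surv Z n (v @ [0])" and ?B = "surv Z n (v @ [1])"
  have vb: "v @ [b] \<in> tverts" "v @ [b] \<noteq> []" if "b < 2" for b
    using tverts_child[OF Suc.prems(1) that] by auto
  have AB: "?A \<in> below (v @ [0])" "?B \<in> below (v @ [1])"
    using vb by (auto intro!: surv_below)
  have ev: "?A \<in> events" "?B \<in> events" using AB below_events by blast+
  \<comment> \<open>Inclusion-exclusion; the children have disjoint subtrees, so the intersection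
    term factorises.\<close>
  have "prob (?A \<union> ?B) = prob ?A + prob ?B - prob ?A * prob ?B"
    using ev prob_children[OF Suc.prems AB]
    by (simp add: finite_measure_Union' finite_measure_Diff' Int_commute)
  also have "\<dots> = 1 - (1 - surv_prob p n)\<^sup>2"
    using Suc.IH vb by (simp add: power2_eq_square algebra_simps)
  finally have "prob (?A \<union> ?B) = 1 - (1 - surv_prob p n)\<^sup>2" .
  moreover have "?A \<union> ?B \<in> sigma_sets (space M) (Z ` (descendants v - {v}))"
    using AB below_child by blast
  ultimately show ?case using prob_root[OF Suc.prems] by simp
qed

text \<open>Continuity from above along the decreasing events \<open>surv\<close>, whose
  probabilities do not depend on \<open>v\<close>.\<close>

lemma prob_perc_lim:
  assumes "v \<in> tverts" "v \<noteq> []"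
  shows "surv_prob p \<longlonglongrightarrow> prob (perc Z v)"
proof -
  have "(\<lambda>n. prob (surv Z n v)) \<longlonglongrightarrow> prob (perc Z v)"
    unfolding perc_def
  proof (intro finite_Lim_measure_decseq decseq_surv)
    show "range (\<lambda>n. surv Z n v) \<subseteq> events"
      using surv_below[OF assms] below_events[OF assms(2)] by fast
  qed
  then show ?thesis using prob_surv[OF assms] by simp
qed

text \<open>Open paths leaving \<open>v\<close> through different children combine to a line with
  apex \<open>v\<close>.\<close>

definition fork :: "nat list \<Rightarrow> 'w set" where
  "fork v = Z v \<inter> (perc Z (v @ [0]) \<inter> perc Z (v @ [1]))"

lemma fork_below:
  assumes "v \<in> tverts" "v \<noteq> []"
  shows "fork v \<in> below v"
proof -
  interpret A: sigma_algebra "space M" "below v"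
    using below_Pow[OF assms(2)] by (rule sigma_algebra_sigma_sets)
  have "perc Z (v @ [b]) \<in> below v" if "b < 2" for b
    using perc_below[of "v @ [b]"] tverts_child[OF assms(1) that] below_child' by blast
  from this[of 0] this[of 1] have "perc Z (v @ [0]) \<inter> perc Z (v @ [1]) \<in> below v"
    using A.Int by auto
  moreover have "Z v \<in> below v" using assms by (auto simp: descendants_def)
  ultimately show ?thesis unfolding fork_def by blast
qed

text \<open>The site and the percolation events of its children are independent, and each child
  percolates with probability at least the fixed point. The bound is the same for all
  \<open>v\<close>.\<close>

lemma prob_fork:
  assumes "v \<in> tverts" "v \<noteq> []" "1 / 2 < p" "p \<le> 1"
  shows "p * (2 - 1 / p)\<^sup>2 \<le> prob (fork v)"
proof -
  interpret A: sigma_algebra "space M" "sigma_sets (space M) (Z ` (descendants v - {v}))"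
    using strict_below_algebra[OF assms(2)] .
  let ?A = "perc Z (v @ [0])" and ?B = "perc Z (v @ [1])"
  have vb: "v @ [b] \<in> tverts" "v @ [b] \<noteq> []" if "b < 2" for b
    using tverts_child[OF assms(1) that] by auto
  have AB: "?A \<in> below (v @ [0])" "?B \<in> below (v @ [1])"
    using vb by (auto intro!: perc_below)
  have ge: "2 - 1 / p \<le> prob (perc Z (v @ [b]))" if "b < 2" for b
    using prob_perc_lim[OF vb[OF that]] surv_prob_supercritical[OF assms(3,4)]
    by (auto intro!: LIMSEQ_le_const)
  have pos: "0 \<le> 2 - 1 / p" using assms(3) by (simp add: field_simps)
  have "?A \<inter> ?B \<in> sigma_sets (space M) (Z ` (descendants v - {v}))"
    using AB below_child by blast
  then have "prob (fork v) = p * (prob ?A * prob ?B)"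
    using prob_root[OF assms(1,2)] prob_children[OF assms(1,2) AB] by (simp add: fork_def)
  moreover have "(2 - 1 / p)\<^sup>2 \<le> prob ?A * prob ?B"
    unfolding power2_eq_square using ge pos by (intro mult_mono) auto
  ultimately show ?thesis using assms(3) by (simp add: mult_left_mono)
qed

end

section \<open>The Poisson process of lines\<close>

text \<open>Measurability follows from the prescribed positive value, since \<open>emeasure\<close> is \<open>0\<close> outside
  the \<open>\<sigma>\<close>-algebra.\<close>

lemma through2_in_sets:
  assumes "is_line_measure \<mu>" "x \<in> tverts" "y \<in> tverts" "x \<noteq> y"
  shows "through2 x y \<in> sets \<mu>" "emeasure \<mu> (through2 x y) = ennreal ((1 / 2) ^ tdist x y)"
proof -
  show *: "emeasure \<mu> (through2 x y) = ennreal ((1 / 2) ^ tdist x y)"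
    using assms by (simp add: is_line_measure_def)
  have "emeasure \<mu> (through2 x y) \<noteq> 0" unfolding * by (simp add: ennreal_eq_0_iff not_le)
  then show "through2 x y \<in> sets \<mu>" by (rule emeasure_neq_0_sets)
qed

lemma space_line_measure: "is_line_measure \<mu> \<Longrightarrow> space \<mu> = tlines"
proof -
  assume "is_line_measure \<mu>"
  then have "space \<mu> = space line_borel"
    by (intro sets_eq_imp_space_eq) (simp add: is_line_measure_def)
  also have "\<dots> = tlines"
    unfolding line_borel_def by (intro space_measure_of) (auto simp: line_opens_def)
  finally show ?thesis .
qed

locale poisson_lines =
  fixes \<mu> :: "nat list set measure" and M :: "'w measure"
    and PP :: "'w \<Rightarrow> nat list set set" and \<alpha> :: real
  assumes line_measure: "is_line_measure \<mu>"
    and alpha_pos: "\<alpha> > 0"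
    and poisson: "poisson_process M (scale_measure (ennreal \<alpha>) \<mu>) PP"

sublocale poisson_lines \<subseteq> prob_space M
  using poisson by (simp add: poisson_process_def)

context poisson_lines
begin

text \<open>Phrased with \<open>card\<close>, as the Poisson law is. Since \<open>card\<close> is 0
  on infinite sets too, this means emptiness only up to a null set, see
  \<open>AE_void\<close>.\<close>

definition void :: "nat list set set \<Rightarrow> 'w set" where
  "void A = {\<omega> \<in> space M. card (PP \<omega> \<inter> A) = 0}"

lemma PP_subset: "\<omega> \<in> space M \<Longrightarrow> PP \<omega> \<subseteq> tlines"
  using poisson space_line_measure[OF line_measure] by (auto simp: poisson_process_def space_scale_measure)

lemma scaled_finite: "A \<in> fmeasurable \<mu> \<Longrightarrow> emeasure (scale_measure (ennreal \<alpha>) \<mu>) A < \<infinity>"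
  by (auto simp: fmeasurable_def ennreal_mult_less_top)

lemma void_vimage: "void A = (\<lambda>\<omega>. card (PP \<omega> \<inter> A)) -` {0} \<inter> space M"
  by (auto simp: void_def)

lemma
  assumes "A \<in> fmeasurable \<mu>"
  shows void_events: "void A \<in> events"
    and prob_void: "prob (void A) = exp (- \<alpha> * measure \<mu> A)"
    and AE_void: "AE \<omega> in M. \<omega> \<in> void A \<longrightarrow> PP \<omega> \<inter> A = {}"
proof -
  have A: "A \<in> sets (scale_measure (ennreal \<alpha>) \<mu>)" using assms by (simp add: fmeasurable_def)
  let ?\<nu> = "scale_measure (ennreal \<alpha>) \<mu>"
  have count: "\<forall>A\<in>sets ?\<nu>. emeasure ?\<nu> A < \<infinity> \<longrightarrow>
      (AE \<omega> in M. finite (PP \<omega> \<inter> A)) \<and>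
      (\<lambda>\<omega>. card (PP \<omega> \<inter> A)) \<in> measurable M (count_space UNIV) \<and>
      (\<forall>k. prob {\<omega>\<in>space M. card (PP \<omega> \<inter> A) = k} =
        exp (- enn2real (emeasure ?\<nu> A)) * enn2real (emeasure ?\<nu> A) ^ k / fact k)"
    using poisson unfolding poisson_process_def by (elim conjE) assumption
  have p: "AE \<omega> in M. finite (PP \<omega> \<inter> A)"
    "(\<lambda>\<omega>. card (PP \<omega> \<inter> A)) \<in> measurable M (count_space UNIV)"
    "\<And>k. measure M {\<omega>\<in>space M. card (PP \<omega> \<inter> A) = k} =
      exp (- enn2real (emeasure (scale_measure (ennreal \<alpha>) \<mu>) A)) *
      enn2real (emeasure (scale_measure (ennreal \<alpha>) \<mu>) A) ^ k / fact k"
    using count A scaled_finite[OF assms] by blast+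
  show "void A \<in> events" unfolding void_vimage using p(2) by (rule measurable_sets) simp
  show "prob (void A) = exp (- \<alpha> * measure \<mu> A)"
    using p(3)[of 0] alpha_pos by (simp add: void_def enn2real_mult measure_def)
  show "AE \<omega> in M. \<omega> \<in> void A \<longrightarrow> PP \<omega> \<inter> A = {}"
    using p(1) by eventually_elim (auto simp: void_def)
qed

lemma indep_vars_counts:
  fixes A :: "nat \<Rightarrow> nat list set set"
  assumes "finite K" "\<And>k. k \<in> K \<Longrightarrow> A k \<in> fmeasurable \<mu>" "disjoint_family_on A K"
  shows "indep_vars (\<lambda>_. count_space UNIV) (\<lambda>k \<omega>. card (PP \<omega> \<inter> A k)) K"
proof -
  let ?\<nu> = "scale_measure (ennreal \<alpha>) \<mu>"
  have "\<forall>I (A :: nat \<Rightarrow> nat list set set). finite I \<longrightarrow> A ` I \<subseteq> sets ?\<nu> \<longrightarrow>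
      (\<forall>i\<in>I. emeasure ?\<nu> (A i) < \<infinity>) \<longrightarrow> disjoint_family_on A I \<longrightarrow>
      indep_vars (\<lambda>_. count_space UNIV) (\<lambda>i \<omega>. card (PP \<omega> \<inter> A i)) I"
    using poisson unfolding poisson_process_def by (elim conjE) assumption
  moreover have "A ` K \<subseteq> sets ?\<nu>" using assms(2) by (auto simp: fmeasurable_def)
  ultimately show ?thesis using assms scaled_finite[OF assms(2)] by metis
qed

text \<open>Independence of counts is given for families indexed by naturals. Independence of events
  concerns finite subfamilies only, and \<open>h\<close> enumerates each of them.\<close>

lemma indep_void:
  fixes A :: "'i \<Rightarrow> nat list set set"
  assumes A: "\<And>i. i \<in> I \<Longrightarrow> A i \<in> fmeasurable \<mu>" and disj: "disjoint_family_on A I"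
  shows "indep_events (\<lambda>i. void (A i)) I"
  unfolding indep_events_def
proof (intro conjI allI impI)
  show "(\<lambda>i. void (A i)) ` I \<subseteq> events" using void_events[OF A] by blast
  fix J assume J: "J \<subseteq> I" "J \<noteq> {}" "finite J"
  from J(3) obtain h where h: "bij_betw h {0..<card J} J" using ex_bij_betw_nat_finite by blast
  let ?K = "{0..<card J}"
  have hJ: "h ` ?K = J" and inj: "inj_on h ?K" using h by (auto simp: bij_betw_def)
  have "disjoint_family_on (\<lambda>k. A (h k)) ?K"
    unfolding disjoint_family_on_def
  proof (intro ballI impI)
    fix k l assume kl: "k \<in> ?K" "l \<in> ?K" "k \<noteq> l"
    then have "h k \<noteq> h l" "h k \<in> I" "h l \<in> I" using inj hJ J(1) by (auto dest: inj_onD)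
    then show "A (h k) \<inter> A (h l) = {}" using disj by (auto simp: disjoint_family_on_def)
  qed
  moreover have "A (h k) \<in> fmeasurable \<mu>" if "k \<in> ?K" for k using that hJ J(1) A by blast
  ultimately have "indep_vars (\<lambda>_. count_space UNIV) (\<lambda>k \<omega>. card (PP \<omega> \<inter> A (h k))) ?K"
    by (intro indep_vars_counts) simp_all
  from indep_varsD[OF this, of ?K "\<lambda>_. {0}"] J
  have "prob (\<Inter>k\<in>?K. void (A (h k))) = (\<Prod>k\<in>?K. prob (void (A (h k))))"
    unfolding void_vimage by simp
  also have "(\<Inter>k\<in>?K. void (A (h k))) = (\<Inter>j\<in>J. void (A j))"
  proof -
    have "(\<Inter>k\<in>?K. void (A (h k))) = (\<Inter>j\<in>h ` ?K. void (A j))" by (simp only: image_image)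
    then show ?thesis by (simp only: hJ)
  qed
  also have "(\<Prod>k\<in>?K. prob (void (A (h k)))) = (\<Prod>j\<in>J. prob (void (A j)))"
    using prod.reindex_bij_betw[OF h] by fast
  finally show "prob (\<Inter>j\<in>J. void (A j)) = (\<Prod>j\<in>J. prob (void (A j)))" .
qed

lemma through2_fmeasurable: "x \<in> tverts \<Longrightarrow> y \<in> tverts \<Longrightarrow> x \<noteq> y \<Longrightarrow> through2 x y \<in> fmeasurable \<mu>"
  using through2_in_sets[OF line_measure] by (simp add: fmeasurable_def)

lemma measure_through2:
  "x \<in> tverts \<Longrightarrow> y \<in> tverts \<Longrightarrow> x \<noteq> y \<Longrightarrow> measure \<mu> (through2 x y) = (1 / 2) ^ tdist x y"
  using through2_in_sets[OF line_measure] by (simp add: measure_def)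

lemma apex_lines_fmeasurable: "v \<in> tverts \<Longrightarrow> apex_lines v \<in> fmeasurable \<mu>"
  unfolding apex_lines_def by (intro through2_fmeasurable tverts_child) auto

abbreviation no_apex :: "nat list \<Rightarrow> 'w set" where
  "no_apex v \<equiv> void (apex_lines v)"

lemma prob_no_apex: "v \<in> tverts \<Longrightarrow> prob (no_apex v) = exp (- \<alpha> / 4)"
proof -
  assume v: "v \<in> tverts"
  have "measure \<mu> (apex_lines v) = (1 / 2) ^ tdist (v @ [0]) (v @ [1])"
    unfolding apex_lines_def using v by (intro measure_through2 tverts_child) auto
  also have "\<dots> = 1 / 4" by (subst tdist_siblings) (auto simp: power2_eq_square)
  finally show ?thesis using prob_void[OF apex_lines_fmeasurable[OF v]] by simp
qed

end

sublocale poisson_lines \<subseteq> site_percolation M no_apex "exp (- \<alpha> / 4)"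
proof
  show "indep_events no_apex (tverts - {[]})"
    by (rule indep_void)
      (use apex_lines_fmeasurable apex_lines_disjoint in \<open>auto simp: disjoint_family_on_def\<close>)
qed (rule prob_no_apex)

context poisson_lines
begin

text \<open>Sites are open with probability at most 1/2, so almost surely none of the countably many
  non-root vertices percolates. The descending part of a vacant half-line would be an open path,
  since a line with apex \<open>z k\<close> contains \<open>z k\<close>.\<close>

lemma no_halfline:
  assumes "\<alpha> \<ge> 4 * ln 2"
  shows "AE \<omega> in M. \<not> (\<exists>H\<in>thalflines. H \<subseteq> vacant (PP \<omega>))"
proof -
  have "exp (- \<alpha> / 4) \<le> exp (- ln 2)" using assms by (subst exp_le_cancel_iff) simp
  then have p: "exp (- \<alpha> / 4) \<le> 1 / 2" by (simp add: exp_minus)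
  have "AE \<omega> in M. \<omega> \<notin> perc no_apex v" if v: "v \<in> tverts" "v \<noteq> []" for v
  proof -
    have "prob (perc no_apex v) = 0"
      using prob_perc_lim[OF v] surv_prob_subcritical[OF _ p] by (simp add: LIMSEQ_unique)
    then show ?thesis using prob_eq_0 below_events[OF v(2) perc_below[OF v]] by blast
  qed
  then have "AE \<omega> in M. \<forall>v\<in>tverts - {[]}. \<omega> \<notin> perc no_apex v"
    by (subst AE_ball_countable) auto
  then show ?thesis
  proof (rule AE_mp, intro AE_I2 impI notI)
    fix \<omega> assume w: "\<omega> \<in> space M" "\<forall>v\<in>tverts - {[]}. \<omega> \<notin> perc no_apex v"
      and "\<exists>H\<in>thalflines. H \<subseteq> vacant (PP \<omega>)"
    then obtain H where H: "H \<in> thalflines" "H \<subseteq> vacant (PP \<omega>)" by blast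
    obtain z where z: "\<And>k. z k \<in> H" "\<And>k. z k \<in> tverts" "z 0 \<noteq> []"
      "\<And>k. \<exists>b<2. z (Suc k) = z k @ [b]"
      using halfline_descends[OF H(1)] by metis
    have "\<omega> \<in> no_apex (z k)" for k
    proof -
      have "z k \<in> vacant (PP \<omega>)" using z(1) H(2) by blast
      then have "PP \<omega> \<inter> apex_lines (z k) = {}"
        using apex_in_line by (auto simp: vacant_def)
      then show ?thesis using w(1) by (simp add: void_def)
    qed
    then have "\<omega> \<in> surv no_apex n (z 0)" for n by (intro surv_if_path z(4))
    then have "\<omega> \<in> perc no_apex (z 0)" by (simp add: perc_def)
    with w(2) z(2,3) show False by blast
  qed
qed

end

section \<open>Vacant lines in the supercritical case\<close>

lemma path_prefix:
  assumes "\<And>k. \<exists>b. f (Suc k) = f k @ [b]" "prefix v (f k)"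
  shows "prefix v (f 0) \<or> (\<exists>j. v = f j)"
  using assms(2)
proof (induction k)
  case (Suc k)
  obtain b where "f (Suc k) = f k @ [b]" using assms(1) by blast
  with Suc show ?case by (metis prefix_snoc)
qed simp

text \<open>Two open paths from \<open>y\<close> form a line. A line of \<open>P\<close> meeting it
  either uses the edge above \<open>y\<close>, which is excluded, or has its apex between
  \<open>y\<close> and the meeting point; that apex lies on the two paths and is open, a
  contradiction.\<close>

lemma fork_line_vacant:
  assumes P: "P \<subseteq> tlines" "P \<inter> through2 (butlast y) y = {}"
    and Z: "\<And>v. v \<in> tverts \<Longrightarrow> \<omega> \<in> Z v \<Longrightarrow> P \<inter> apex_lines v = {}"
    and y: "y \<in> tverts" "y \<noteq> []" "\<omega> \<in> Z y"
    and perc: "\<omega> \<in> perc Z (y @ [0])" "\<omega> \<in> perc Z (y @ [1])"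
  shows "\<exists>L\<in>tlines. L \<subseteq> vacant P"
proof -
  obtain f where f: "f 0 = y @ [0]" "\<And>k. \<omega> \<in> Z (f k)" "\<And>k. f k \<in> descendants (y @ [0])"
    "\<And>k. \<exists>b. f (Suc k) = f k @ [b]"
    using perc_path[OF perc(1)] tverts_child[OF y(1), of 0] by auto
  obtain g where g: "g 0 = y @ [1]" "\<And>k. \<omega> \<in> Z (g k)" "\<And>k. g k \<in> descendants (y @ [1])"
    "\<And>k. \<exists>b. g (Suc k) = g k @ [b]"
    using perc_path[OF perc(2)] tverts_child[OF y(1), of 1] by auto
  let ?L = "insert y (range f \<union> range g)"
  have fg: "f k \<in> tverts" "g k \<in> tverts" "prefix y (f k)" "prefix y (g k)" for k
    using f(3)[of k] g(3)[of k] by (auto simp: descendants_def dest: append_prefixD)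
  have clear: "P \<inter> apex_lines w = {}" if "w \<in> ?L" for w
    using that y f(2) g(2) fg Z by blast
  \<comment> \<open>Each path grows by one letter at a time, so it contains every vertex between
    \<open>y\<close> and one of its own.\<close>
  have prefix_closed: "v \<in> ?L" if v: "prefix y v" "prefix v u" "u \<in> ?L" for u v
  proof -
    from v(3) consider "u = y" | k where "u = f k" | k where "u = g k" by blast
    then show ?thesis
    proof cases
      case 1
      with v have "v = y" by (simp add: prefix_order.antisym)
      then show ?thesis by simp
    next
      case 2
      with path_prefix[where f = f, OF f(4)] v(2) consider "prefix v (y @ [0])" | j where "v = f j"
        unfolding f(1) by metis
      then show ?thesis
      proof cases
        case 1
        then have "v = y \<or> v = f 0" using v(1) f(1) by (auto simp: prefix_order.antisym)
        then show ?thesis by blast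
      qed blast
    next
      case 3
      with path_prefix[where f = g, OF g(4)] v(2) consider "prefix v (y @ [1])" | j where "v = g j"
        unfolding g(1) by metis
      then show ?thesis
      proof cases
        case 1
        then have "v = y \<or> v = g 0" using v(1) g(1) by (auto simp: prefix_order.antisym)
        then show ?thesis by blast
      qed blast
    qed
  qed
  have "u \<notin> \<Union> P" if u: "u \<in> ?L" for u
  proof
    assume "u \<in> \<Union> P"
    then obtain K where K: "K \<in> P" "u \<in> K" by blast
    have "prefix y u" using u fg by auto
    then obtain s where s: "u = y @ s" by (auto simp: prefix_def)
    have "K \<in> tlines" "y @ s \<in> K" using K P(1) s by auto
    from line_exits_or_apex[OF this(1) y(2) this(2)]
    consider "butlast y \<in> K" "y \<in> K" | v where "prefix y v" "prefix v u" "K \<in> apex_lines v"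
      using s by blast
    then show False
    proof cases
      case 1
      with K \<open>K \<in> tlines\<close> P(2) show False by (auto simp: through2_def)
    next
      case (2 v)
      with prefix_closed u have "v \<in> ?L" by blast
      with clear K(1) 2(3) show False by blast
    qed
  qed
  moreover have "?L \<subseteq> tverts" using y fg by blast
  ultimately have "?L \<subseteq> vacant P" unfolding vacant_def by blast
  moreover have "?L \<in> tlines"
    by (rule two_rays_line[where f = f and g = g, OF f(1,4) fg(1) g(1,4) fg(2)])
  ultimately show ?thesis by blast
qed

text \<open>\<open>Q\<close> may fail to be measurable, so events \<open>E j\<close> stand in for
  it: their union has probability 1, and \<open>Q\<close> holds almost surely on each.\<close>

lemma (in prob_space) AE_if_large_events:
  assumes "\<And>e. e > 0 \<Longrightarrow> \<exists>E\<in>events. 1 - e \<le> prob E \<and> (AE \<omega> in M. \<omega> \<in> E \<longrightarrow> Q \<omega>)"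
  shows "AE \<omega> in M. Q \<omega>"
proof -
  have "\<forall>j::nat. \<exists>E\<in>events. 1 - 1 / Suc j \<le> prob E \<and> (AE \<omega> in M. \<omega> \<in> E \<longrightarrow> Q \<omega>)"
    using assms by simp
  then obtain E where E: "\<And>j::nat. E j \<in> events" "\<And>j. 1 - 1 / Suc j \<le> prob (E j)"
    "\<And>j. AE \<omega> in M. \<omega> \<in> E j \<longrightarrow> Q \<omega>"
    by metis
  have U: "(\<Union>j. E j) \<in> events" using E(1) by auto
  have "1 - 1 / Suc j \<le> prob (\<Union>j. E j)" for j
    using E(2)[of j] finite_measure_mono[OF _ U, of "E j"] by fastforce
  moreover have "(\<lambda>j. 1 - 1 / Suc j) \<longlonglongrightarrow> (1::real) - 0"
    using LIMSEQ_inverse_real_of_nat by (intro tendsto_intros) (simp add: inverse_eq_divide)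
  ultimately have "1 - 0 \<le> prob (\<Union>j. E j)" by (intro LIMSEQ_le_const2) auto
  then have "prob (\<Union>j. E j) = 1" using prob_le_1 by (simp add: antisym)
  then have "AE \<omega> in M. \<omega> \<in> (\<Union>j. E j)" using prob_eq_1[OF U] by simp
  moreover have "AE \<omega> in M. \<forall>j. \<omega> \<in> E j \<longrightarrow> Q \<omega>" unfolding AE_all_countable using E(3) by blast
  ultimately show ?thesis by eventually_elim blast
qed

text \<open>Percolation is tried in \<open>n\<close> disjoint subtrees with roots \<open>y k\<close>.  The trials interact only
  through the lines in \<open>multi\<close>, which have small measure when the roots are far apart.\<close>

locale trials = poisson_lines \<mu> M PP \<alpha>
  for \<mu> :: "nat list set measure" and M :: "'w measure"
    and PP :: "'w \<Rightarrow> nat list set set" and \<alpha> :: real +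
  fixes n :: nat and y :: "nat \<Rightarrow> nat list"
  assumes y: "k < n \<Longrightarrow> y k \<in> tverts" "k < n \<Longrightarrow> y k \<noteq> []"
    and incomparable: "k < n \<Longrightarrow> l < n \<Longrightarrow> k \<noteq> l \<Longrightarrow> \<not> prefix (y k) (y l)"
begin

definition multi :: "nat list set set" where
  "multi = (\<Union>(k, l)\<in>{(k, l). k < n \<and> l < n \<and> k \<noteq> l}. through2 (y k) (y l))"

text \<open>A line entering two of the subtrees from above contains both roots and so lies in
  \<open>multi\<close>. Removing \<open>multi\<close> makes these classes disjoint for different
  \<open>k\<close>.\<close>

definition entering :: "nat \<Rightarrow> nat list set set" where
  "entering k = through2 (butlast (y k)) (y k) - multi"

text \<open>The sum type puts both kinds of line classes into one disjoint family, so that all their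
  void events are jointly independent.\<close>

definition family :: "nat list + nat \<Rightarrow> nat list set set" where
  "family = case_sum apex_lines entering"

definition indices :: "nat \<Rightarrow> (nat list + nat) set" where
  "indices k = insert (Inr k) (Inl ` descendants (y k))"

definition trial :: "nat \<Rightarrow> 'w set" where
  "trial k = void (entering k) \<inter> fork (y k)"

definition success :: "'w set" where
  "success = void multi \<inter> (\<Union>k<n. trial k)"

section \<open>Disjointness, independence and probabilities of the trials\<close>

lemma finite_pairs: "finite {(k, l). k < n \<and> l < n \<and> k \<noteq> l}"
  by (rule finite_subset[of _ "{..<n} \<times> {..<n}"]) auto

lemma y_inj: "k < n \<Longrightarrow> l < n \<Longrightarrow> k \<noteq> l \<Longrightarrow> y k \<noteq> y l"
  using incomparable by fastforce

lemma parent: "k < n \<Longrightarrow> butlast (y k) \<in> tverts" "k < n \<Longrightarrow> butlast (y k) \<noteq> y k"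
proof -
  assume "k < n"
  from y[OF this] show "butlast (y k) \<in> tverts"
    using tverts_snocD[of "butlast (y k)" "last (y k)"] by simp
next
  assume "k < n"
  then have "length (butlast (y k)) \<noteq> length (y k)" using y(2)[of k] by (cases "y k") auto
  then show "butlast (y k) \<noteq> y k" by metis
qed

lemma multi_fmeasurable: "multi \<in> fmeasurable \<mu>"
  unfolding multi_def
proof (rule fmeasurable.finite_UN[OF finite_pairs])
  fix q assume "q \<in> {(k, l). k < n \<and> l < n \<and> k \<noteq> l}"
  then show "(case q of (k, l) \<Rightarrow> through2 (y k) (y l)) \<in> fmeasurable \<mu>"
    using y y_inj by (auto intro!: through2_fmeasurable)
qed

lemma entering_fmeasurable: "k < n \<Longrightarrow> entering k \<in> fmeasurable \<mu>"
  unfolding entering_def using parent y multi_fmeasurable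
  by (intro fmeasurable_Diff through2_fmeasurable) auto

lemma measure_entering: "k < n \<Longrightarrow> measure \<mu> (entering k) \<le> 1 / 2"
proof -
  assume k: "k < n"
  have "measure \<mu> (entering k) \<le> measure \<mu> (through2 (butlast (y k)) (y k))"
    using k parent y entering_fmeasurable
    by (intro measure_mono_fmeasurable through2_fmeasurable) (auto simp: entering_def)
  also have "\<dots> = (1 / 2) ^ tdist (butlast (y k)) (y k)"
    using k parent y by (intro measure_through2) auto
  also have "tdist (butlast (y k)) (y k) = 1"
    using y(2)[OF k] by (subst tdist_prefix) (auto simp: prefixeq_butlast Suc_leI)
  finally show ?thesis by simp
qed

text \<open>A line with apex below \<open>y k\<close> stays in the subtree of \<open>y k\<close>.
  That subtree contains no other root \<open>y l\<close>, and it does not contain the parent of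
  \<open>y k\<close>.\<close>

lemma apex_entering_disjoint:
  assumes "k < n" "l < n" "v \<in> descendants (y k)"
  shows "apex_lines v \<inter> entering l = {}"
proof (rule ccontr)
  assume "\<not> ?thesis"
  then obtain L where L: "L \<in> apex_lines v" "butlast (y l) \<in> L" "y l \<in> L"
    by (auto simp: entering_def through2_def)
  have "prefix (y k) v" using assms(3) by (simp add: descendants_def)
  then have *: "prefix (y k) (butlast (y l))" "prefix (y k) (y l)"
    using apex_lines_prefix[OF L(1)] L(2,3) by (meson prefix_order.trans)+
  then have "k = l" using incomparable assms by blast
  with *(1) prefix_length_le have "length (y l) \<le> length (butlast (y l))" by blast
  moreover have "length (y l) > 0" using y(2)[OF assms(2)] by simp
  ultimately show False unfolding length_butlast by linarith
qed

lemma entering_disjoint: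
  assumes "k < n" "l < n" "k \<noteq> l"
  shows "entering k \<inter> entering l = {}"
proof (rule ccontr)
  assume "\<not> ?thesis"
  then obtain L where "L \<in> through2 (y k) (y l)" "L \<notin> multi"
    by (auto simp: entering_def through2_def)
  then show False using assms by (auto simp: multi_def)
qed

lemma indep_family: "indep_events (\<lambda>i. void (family i)) (\<Union>k<n. indices k)"
proof (rule indep_void)
  fix i assume "i \<in> (\<Union>k<n. indices k)"
  then show "family i \<in> fmeasurable \<mu>"
    using apex_lines_fmeasurable entering_fmeasurable
    by (auto simp: family_def indices_def descendants_def)
next
  show "disjoint_family_on family (\<Union>k<n. indices k)"
    unfolding disjoint_family_on_def
  proof (intro ballI impI)
    fix i j assume ij: "i \<in> (\<Union>k<n. indices k)" "j \<in> (\<Union>k<n. indices k)" "i \<noteq> j"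
    then obtain k l where kl: "k < n" "l < n" "i \<in> indices k" "j \<in> indices l" by blast
    show "family i \<inter> family j = {}"
    proof (cases i; cases j)
      fix v w assume "i = Inl v" "j = Inl w"
      with ij(3) show ?thesis using apex_lines_disjoint[of _ v w] by (auto simp: family_def)
    next
      fix v l' assume "i = Inl v" "j = Inr l'"
      with kl show ?thesis using apex_entering_disjoint[of k l v]
        by (auto simp: family_def indices_def)
    next
      fix k' w assume "i = Inr k'" "j = Inl w"
      with kl show ?thesis using apex_entering_disjoint[of l k w]
        by (auto simp: family_def indices_def)
    next
      fix k' l' assume "i = Inr k'" "j = Inr l'"
      with kl ij(3) show ?thesis using entering_disjoint[of k l]
        by (auto simp: family_def indices_def)
    qed
  qed
qed

lemma indices_disjoint:
  assumes "k < n" "l < n" "k \<noteq> l"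
  shows "indices k \<inter> indices l = {}"
proof -
  have "descendants (y k) \<inter> descendants (y l) = {}"
    using incomparable[OF assms] incomparable[OF assms(2,1)] assms(3)
    by (auto simp: descendants_def dest: prefix_same_cases)
  with assms(3) show ?thesis by (auto simp: indices_def)
qed

abbreviation algebra_of :: "(nat list + nat) set \<Rightarrow> 'w set set" where
  "algebra_of J \<equiv> sigma_sets (space M) ((\<lambda>i. void (family i)) ` J)"

lemma algebra_of: "sigma_algebra (space M) (algebra_of J)"
  by (rule sigma_algebra_sigma_sets) (auto simp: void_def)

lemma fork_algebra: "k < n \<Longrightarrow> fork (y k) \<in> algebra_of (Inl ` descendants (y k))"
  using fork_below[OF y, of k] by (simp add: image_image family_def)

lemma trial_algebra: "k < n \<Longrightarrow> trial k \<in> algebra_of (indices k)"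
proof -
  assume k: "k < n"
  interpret A: sigma_algebra "space M" "algebra_of (indices k)" by (rule algebra_of)
  have "algebra_of (Inl ` descendants (y k)) \<subseteq> algebra_of (indices k)"
    by (intro sigma_sets_mono' image_mono) (auto simp: indices_def)
  then have "fork (y k) \<in> algebra_of (indices k)" using fork_algebra[OF k] by blast
  moreover have "void (family (Inr k)) \<in> algebra_of (indices k)"
    by (intro sigma_sets.Basic imageI) (simp add: indices_def)
  ultimately have "void (family (Inr k)) \<inter> fork (y k) \<in> algebra_of (indices k)"
    by (rule A.Int[rotated])
  then show ?thesis by (simp add: trial_def family_def)
qed

lemma algebra_of_events:
  assumes "J \<subseteq> (\<Union>k<n. indices k)" "A \<in> algebra_of J"
  shows "A \<in> events"
proof -
  have "(\<lambda>i. void (family i)) ` (\<Union>k<n. indices k) \<subseteq> events"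
    using indep_family unfolding indep_events_def by (rule conjunct1)
  with image_mono[OF assms(1)] have "(\<lambda>i. void (family i)) ` J \<subseteq> events"
    by (rule order_trans)
  then show ?thesis using assms(2) sets.sigma_sets_subset by blast
qed

lemma trial_events: "k < n \<Longrightarrow> trial k \<in> events"
  by (rule algebra_of_events[OF _ trial_algebra]) auto

lemma prob_trial:
  assumes k: "k < n"
  shows "prob (trial k) = prob (void (entering k)) * prob (fork (y k))"
proof -
  have "prob (void (family (Inr k)) \<inter> fork (y k)) =
      prob (void (family (Inr k))) * prob (fork (y k))"
  proof (rule indep_events_prob_Int[OF indep_family _ _ _ _ fork_algebra[OF k]])
    show "void (family (Inr k)) \<in> algebra_of {Inr k}" by simp
    show "{Inr k} \<subseteq> (\<Union>k<n. indices k)" "Inl ` descendants (y k) \<subseteq> (\<Union>k<n. indices k)"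
      using k by (auto simp: indices_def)
  qed auto
  then show ?thesis by (simp add: trial_def family_def)
qed

text \<open>The induction carries membership in the sigma-algebra of the first \<open>j\<close>
  index sets along, because this gives independence from the next trial.\<close>

lemma prob_no_trial:
  assumes c: "\<And>k. k < n \<Longrightarrow> c \<le> prob (trial k)" "c \<le> 1"
  shows "j \<le> n \<Longrightarrow> {\<omega> \<in> space M. \<forall>k<j. \<omega> \<notin> trial k} \<in> algebra_of (\<Union>k<j. indices k) \<and>
    prob {\<omega> \<in> space M. \<forall>k<j. \<omega> \<notin> trial k} \<le> (1 - c) ^ j"
proof (induction j)
  case 0
  interpret A: sigma_algebra "space M" "algebra_of {}" by (rule algebra_of)
  show ?case using A.top by (simp add: prob_space)
next
  case (Suc j)
  let ?G = "{\<omega> \<in> space M. \<forall>k<j. \<omega> \<notin> trial k}"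
  have j: "j < n" using Suc.prems by simp
  have eq: "{\<omega> \<in> space M. \<forall>k<Suc j. \<omega> \<notin> trial k} = ?G \<inter> (space M - trial j)"
    by (auto simp: less_Suc_eq)
  have IH: "?G \<in> algebra_of (\<Union>k<j. indices k)" "prob ?G \<le> (1 - c) ^ j" using Suc by auto
  have T: "space M - trial j \<in> algebra_of (indices j)"
    by (rule sigma_sets.Compl[OF trial_algebra[OF j]])
  interpret A: sigma_algebra "space M" "algebra_of (\<Union>k<Suc j. indices k)" by (rule algebra_of)
  have "algebra_of (\<Union>k<j. indices k) \<subseteq> algebra_of (\<Union>k<Suc j. indices k)"
    "algebra_of (indices j) \<subseteq> algebra_of (\<Union>k<Suc j. indices k)"
    by (intro sigma_sets_mono' image_mono; force simp: less_Suc_eq)+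
  then have "?G \<inter> (space M - trial j) \<in> algebra_of (\<Union>k<Suc j. indices k)"
    using IH(1) T by (intro A.Int) blast+
  moreover have "prob (?G \<inter> (space M - trial j)) \<le> (1 - c) ^ j * (1 - c)"
  proof -
    have "prob (?G \<inter> (space M - trial j)) = prob ?G * prob (space M - trial j)"
    proof (rule indep_events_prob_Int[OF indep_family _ _ _ IH(1) T])
      show "(\<Union>k<j. indices k) \<subseteq> (\<Union>k<n. indices k)" "indices j \<subseteq> (\<Union>k<n. indices k)"
        using j by force+
      show "(\<Union>k<j. indices k) \<inter> indices j = {}"
      proof -
        have "indices k \<inter> indices j = {}" if "k < j" for k
          using indices_disjoint[of k j] that j by simp
        then show ?thesis by blast
      qed
    qed
    also have "prob (space M - trial j) = 1 - prob (trial j)"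
      using trial_events j by (intro prob_compl) blast
    also have "prob ?G * (1 - prob (trial j)) \<le> (1 - c) ^ j * (1 - c)"
      using IH(2) c(1)[OF j] c(2) by (intro mult_mono) auto
    finally show ?thesis .
  qed
  ultimately show ?case unfolding eq by (simp add: mult.commute)
qed

lemma success_events: "success \<in> events"
  unfolding success_def using void_events[OF multi_fmeasurable] trial_events by auto

text \<open>No independence between \<open>void multi\<close> and the trials enters: the probability
  that all trials fail is subtracted from that of \<open>void multi\<close>, which is bounded by
  \<open>1 + x \<le> exp x\<close>.\<close>

lemma prob_success:
  assumes "\<And>k. k < n \<Longrightarrow> c \<le> prob (trial k)" "c \<le> 1"
  shows "1 - \<alpha> * measure \<mu> multi - (1 - c) ^ n \<le> prob success"
proof -
  let ?G = "{\<omega> \<in> space M. \<forall>k<n. \<omega> \<notin> trial k}"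
  have G: "?G \<in> events" "prob ?G \<le> (1 - c) ^ n"
    using prob_no_trial[OF assms, of n] algebra_of_events[of "\<Union>k<n. indices k"] by auto
  have ev: "void multi \<in> events" using void_events[OF multi_fmeasurable] .
  have "1 + - \<alpha> * measure \<mu> multi \<le> prob (void multi)"
    unfolding prob_void[OF multi_fmeasurable] by (rule exp_ge_add_one_self)
  moreover have "void multi - ?G \<subseteq> success"
    by (auto simp: success_def void_def)
  then have "prob (void multi - ?G) \<le> prob success"
    by (rule finite_measure_mono[OF _ success_events])
  moreover have "prob (void multi - ?G) = prob (void multi) - prob (void multi \<inter> ?G)"
    using ev G(1) by (rule finite_measure_Diff')
  moreover have "prob (void multi \<inter> ?G) \<le> prob ?G"
    by (rule finite_measure_mono[OF Int_lower2 G(1)])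
  ultimately show ?thesis using G(2) by simp
qed

text \<open>The lines through the edge above \<open>y k\<close> have measure 1/2, which yields the
  factor \<open>exp (- \<alpha> / 2)\<close>. The bound depends on \<alpha> only.\<close>

lemma prob_trial_ge:
  assumes "1 / 2 < exp (- \<alpha> / 4)" "k < n"
  shows "exp (- \<alpha> / 2) * (exp (- \<alpha> / 4) * (2 - 1 / exp (- \<alpha> / 4))\<^sup>2) \<le> prob (trial k)"
  unfolding prob_trial[OF assms(2)]
proof (intro mult_mono)
  have "\<alpha> * measure \<mu> (entering k) \<le> \<alpha> * (1 / 2)"
    using measure_entering[OF assms(2)] alpha_pos by (intro mult_left_mono) auto
  then show "exp (- \<alpha> / 2) \<le> prob (void (entering k))"
    unfolding prob_void[OF entering_fmeasurable[OF assms(2)]] by simp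
  show "exp (- \<alpha> / 4) * (2 - 1 / exp (- \<alpha> / 4))\<^sup>2 \<le> prob (fork (y k))"
    using assms y alpha_pos by (intro prob_fork) auto
qed auto

lemma success_line_vacant: "AE \<omega> in M. \<omega> \<in> success \<longrightarrow> (\<exists>L\<in>tlines. L \<subseteq> vacant (PP \<omega>))"
proof -
  have "AE \<omega> in M. \<forall>v\<in>tverts. \<omega> \<in> no_apex v \<longrightarrow> PP \<omega> \<inter> apex_lines v = {}"
    using AE_void[OF apex_lines_fmeasurable] by (subst AE_ball_countable) auto
  moreover have "AE \<omega> in M. \<forall>k\<in>{..<n}. \<omega> \<in> void (entering k) \<longrightarrow> PP \<omega> \<inter> entering k = {}"
    using AE_void[OF entering_fmeasurable] by (subst AE_ball_countable) auto
  moreover note AE_void[OF multi_fmeasurable] AE_space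
  ultimately show ?thesis
  proof eventually_elim
    case (elim \<omega>)
    show ?case
    proof
      assume s: "\<omega> \<in> success"
      then obtain k where k: "k < n" "\<omega> \<in> void (entering k)" "\<omega> \<in> fork (y k)"
        by (auto simp: success_def trial_def)
      have "PP \<omega> \<inter> entering k = {}" "PP \<omega> \<inter> multi = {}"
        using elim k(1,2) s by (auto simp: success_def)
      \<comment> \<open>A line through the edge above \<open>y k\<close> is in
        \<open>entering k\<close> or in \<open>multi\<close>.\<close>
      then have 1: "PP \<omega> \<inter> through2 (butlast (y k)) (y k) = {}" by (auto simp: entering_def)
      have 2: "PP \<omega> \<inter> apex_lines v = {}" if "v \<in> tverts" "\<omega> \<in> no_apex v" for v
        using elim(1) that by blast
      have 3: "\<omega> \<in> no_apex (y k)" "\<omega> \<in> perc no_apex (y k @ [0])" "\<omega> \<in> perc no_apex (y k @ [1])"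
        using k(3) by (auto simp: fork_def)
      from fork_line_vacant[where Z = no_apex, OF PP_subset[OF elim(4)] 1 2 y(1)[OF k(1)] y(2)[OF k(1)] 3]
      show "\<exists>L\<in>tlines. L \<subseteq> vacant (PP \<omega>)" .
    qed
  qed
qed

lemma measure_multi:
  assumes "\<And>k l. k < n \<Longrightarrow> l < n \<Longrightarrow> k \<noteq> l \<Longrightarrow> m \<le> tdist (y k) (y l)"
  shows "measure \<mu> multi \<le> real n ^ 2 * (1 / 2) ^ m"
proof -
  let ?K = "{(k, l). k < n \<and> l < n \<and> k \<noteq> l}"
  have "measure \<mu> multi \<le> (\<Sum>(k, l)\<in>?K. measure \<mu> (through2 (y k) (y l)))"
  proof -
    have "measure \<mu> multi \<le> (\<Sum>q\<in>?K. measure \<mu> (case q of (k, l) \<Rightarrow> through2 (y k) (y l)))"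
      unfolding multi_def using y y_inj fmeasurableD[OF through2_fmeasurable]
      by (intro measure_UNION_le finite_pairs) auto
    then show ?thesis by (simp add: case_prod_beta')
  qed
  also have "\<dots> \<le> (\<Sum>(k, l)\<in>?K. (1 / 2) ^ m)"
  proof (rule sum_mono, clarsimp)
    fix k l assume kl: "k < n" "l < n" "k \<noteq> l"
    then have "measure \<mu> (through2 (y k) (y l)) = (1 / 2) ^ tdist (y k) (y l)"
      using y y_inj by (intro measure_through2) auto
    also have "\<dots> \<le> (1 / 2) ^ m" using assms[OF kl] by (intro power_decreasing) auto
    finally show "measure \<mu> (through2 (y k) (y l)) \<le> (1 / 2) ^ m" .
  qed
  also have "\<dots> = card ?K * (1 / 2) ^ m" by (simp add: case_prod_beta')
  also have "\<dots> \<le> real n ^ 2 * (1 / 2) ^ m"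
  proof (rule mult_right_mono)
    have "card ?K \<le> card ({..<n} \<times> {..<n})" by (rule card_mono) auto
    then show "real (card ?K) \<le> real n ^ 2"
      by (simp add: card_cartesian_product power2_eq_square flip: of_nat_mult)
  qed simp
  finally show ?thesis .
qed

end

text \<open>These vertices branch off the ray 0, 0, 0, ... at multiples of \<open>m\<close>: the
  last letter 1 makes them incomparable, the spacing makes them distant.\<close>

definition trial_root :: "nat \<Rightarrow> nat \<Rightarrow> nat list" where
  "trial_root m k = replicate (Suc k * m) 0 @ [1]"

lemma trial_root_tverts:
  assumes "m > 0"
  shows "trial_root m k \<in> tverts" "trial_root m k \<noteq> []"
proof -
  obtain j where "Suc k * m = Suc j" using assms by (metis gr0_conv_Suc nat_0_less_mult_iff zero_less_Suc)
  then show "trial_root m k \<in> tverts" by (auto simp: trial_root_def tverts_def)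
qed (simp add: trial_root_def)

lemma trial_root_split:
  assumes "m > 0" "k < l"
  obtains r where "m \<le> Suc r"
    "trial_root m k = replicate (Suc k * m) 0 @ [1]"
    "trial_root m l = replicate (Suc k * m) 0 @ 0 # replicate r 0 @ [1]"
proof -
  obtain d where "l = Suc (k + d)" using assms(2) less_iff_Suc_add by auto
  then have "Suc l * m = Suc k * m + Suc d * m" by (simp add: algebra_simps)
  moreover obtain r where r: "Suc d * m = Suc r"
    using assms(1) by (metis gr0_conv_Suc nat_0_less_mult_iff zero_less_Suc)
  ultimately have "trial_root m l = replicate (Suc k * m) 0 @ 0 # replicate r 0 @ [1]"
    unfolding trial_root_def by (simp only: replicate_add append_assoc replicate_Suc append_Cons)
  moreover have "m \<le> Suc r" using r by (metis le_add1 mult_Suc)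
  ultimately show thesis using that by (simp add: trial_root_def)
qed

lemma trial_root_apart:
  assumes "m > 0" "k \<noteq> l"
  shows "m \<le> tdist (trial_root m k) (trial_root m l)" "\<not> prefix (trial_root m k) (trial_root m l)"
proof -
  have *: "m \<le> tdist (trial_root m k) (trial_root m l) \<and> \<not> prefix (trial_root m k) (trial_root m l)
      \<and> \<not> prefix (trial_root m l) (trial_root m k)" if "k < l" for k l
  proof -
    obtain r where r: "m \<le> Suc r" "trial_root m k = replicate (Suc k * m) 0 @ [1]"
      "trial_root m l = replicate (Suc k * m) 0 @ 0 # replicate r 0 @ [1]"
      using trial_root_split[OF assms(1) \<open>k < l\<close>] .
    have "tdist (trial_root m k) (trial_root m l) = tdist [1] (0 # replicate r 0 @ [1])"
      unfolding r(2,3) by (rule tdist_append)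
    also have "\<dots> = r + 3" by (simp add: tdist_def)
    finally have "m \<le> tdist (trial_root m k) (trial_root m l)" using r(1) by simp
    then show ?thesis unfolding r(2,3) by (simp only: same_prefix_prefix) simp
  qed
  show "m \<le> tdist (trial_root m k) (trial_root m l)" "\<not> prefix (trial_root m k) (trial_root m l)"
    using *[of k l] *[of l k] assms(2) tdist_commute[of "trial_root m k" "trial_root m l"]
    by (cases "k < l"; simp)+
qed

lemma (in poisson_lines) vacant_line:
  assumes "\<alpha> < 4 * ln 2"
  shows "AE \<omega> in M. \<exists>L\<in>tlines. L \<subseteq> vacant (PP \<omega>)"
proof (rule AE_if_large_events)
  fix e :: real assume e: "e > 0"
  define p where "p = exp (- \<alpha> / 4)"
  define c where "c = exp (- \<alpha> / 2) * (p * (2 - 1 / p)\<^sup>2)"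
  have "exp (- ln 2) < p" unfolding p_def using assms by (subst exp_less_cancel_iff) simp
  then have p: "1 / 2 < p" "p \<le> 1" using alpha_pos by (simp add: exp_minus, simp add: p_def)
  have "0 < 2 - 1 / p" using p by (simp add: field_simps)
  then have c0: "c > 0" using p by (simp add: c_def)
  \<comment> \<open>The vertex \<open>[0]\<close> is an arbitrary sample: a bound below a
    probability is at most 1, which gives \<open>c \<le> 1\<close>.\<close>
  have "p * (2 - 1 / p)\<^sup>2 \<le> prob (fork [0])"
    using prob_fork[of "[0]"] p by (simp add: p_def tverts_def)
  then have "c \<le> 1 * 1"
    unfolding c_def using alpha_pos p by (intro mult_mono) (auto intro: order_trans[OF _ prob_le_1])
  then have c1: "c \<le> 1" by simp
  \<comment> \<open>\<open>c\<close> depends on \<alpha> only, so the number \<open>n\<close> of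
    trials is fixed first. The spacing \<open>m\<close> is chosen afterwards, so large that the at
    most \<open>n^2\<close> pairs of roots in \<open>multi\<close> cost less than
    \<open>e / 2\<close>.\<close>
  obtain n where n: "(1 - c) ^ n < e / 2"
    using real_arch_pow_inv[of "e / 2" "1 - c"] e c0 by auto
  have "(\<lambda>m. \<alpha> * (real n ^ 2 * (1 / 2) ^ m)) \<longlonglongrightarrow> \<alpha> * (real n ^ 2 * 0)"
    by (intro tendsto_intros LIMSEQ_power_zero) auto
  then have "\<forall>\<^sub>F m in sequentially. \<alpha> * (real n ^ 2 * (1 / 2) ^ m) < e / 2"
    by (rule order_tendstoD(2)) (use e in simp)
  then have "\<forall>\<^sub>F m in sequentially. m > 0 \<and> \<alpha> * (real n ^ 2 * (1 / 2) ^ m) < e / 2"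
    using eventually_gt_at_top[of 0] by eventually_elim simp
  then obtain m where m: "m > 0" "\<alpha> * (real n ^ 2 * (1 / 2) ^ m) < e / 2"
    using eventually_happens' sequentially_bot by blast
  interpret trials \<mu> M PP \<alpha> n "trial_root m"
    by unfold_locales (use trial_root_tverts[OF m(1)] trial_root_apart[OF m(1)] in auto)
  have "\<alpha> * measure \<mu> multi \<le> \<alpha> * (real n ^ 2 * (1 / 2) ^ m)"
    using alpha_pos trial_root_apart[OF m(1)] by (intro mult_left_mono measure_multi) auto
  moreover have "1 - \<alpha> * measure \<mu> multi - (1 - c) ^ n \<le> prob success"
  proof (rule prob_success[OF _ c1])
    show "c \<le> prob (trial k)" if "k < n" for k
      using prob_trial_ge[OF p(1)[unfolded p_def] that] by (simp only: c_def p_def)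
  qed
  ultimately have "1 - e \<le> prob success" using n m(2) by simp
  then show "\<exists>E\<in>events. 1 - e \<le> prob E \<and>
      (AE \<omega> in M. \<omega> \<in> E \<longrightarrow> (\<exists>L\<in>tlines. L \<subseteq> vacant (PP \<omega>)))"
    using success_events success_line_vacant by blast
qed

theorem theorem1:
  fixes \<mu> :: "nat list set measure" and M :: "'w measure"
    and PP :: "'w \<Rightarrow> nat list set set" and \<alpha> :: real
  assumes "is_line_measure \<mu>"
    and "\<alpha> > 0"
    and "poisson_process M (scale_measure (ennreal \<alpha>) \<mu>) PP"
  shows "(\<alpha> < 4 * ln 2 \<longrightarrow> (AE \<omega> in M. \<exists>L\<in>tlines. L \<subseteq> vacant (PP \<omega>)))
       \<and> (\<alpha> \<ge> 4 * ln 2 \<longrightarrow> (AE \<omega> in M. \<not> (\<exists>H\<in>thalflines. H \<subseteq> vacant (PP \<omega>))))"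
proof -
  interpret poisson_lines \<mu> M PP \<alpha> using assms by unfold_locales
  show ?thesis using vacant_line no_halfline by blast
qed

end
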